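(* Suppose $\operatorname{char}\mathcal{F}=0$ and fix $\alpha\in\mathcal{F}$, $\alpha\neq0$. Then $$\dim_{\mathcal H}\{x\in\mathcal{F}:|x|_\mathfrak{p}>1,\ ([\alpha x^n])_{n\ge1}\text{ is not uniformly distributed in }\mathcal{O}\}=1.$$
   Context: $\mathcal{F}$ is a non-Archimedean local field of characteristic $0$ (a finite extension of $\mathbb{Q}_p$) with valuation ring $\mathcal{O}$, maximal ideal $\mathfrak{p}$, $q=\#\mathcal{O}/\mathfrak{p}$, normalized absolute value $|\cdot|_\mathfrak{p}$, prime element $\pi$. Fix representatives $C\subset\mathcal{O}$ of $\mathcal{O}/\mathfrak{p}$ with $0\in C$; writing $x=\sum_{n\ge v}c_n\pi^n$ ($c_n\in C$), $[x]=\sum_{n\ge0}c_n\pi^n$. $D(a,r)=\{x:|x-a|_\mathfrak{p}\le r\}$. A sequence $(x_n)\subset\mathcal{O}$ is uniformly distributed in $\mathcal{O}$ if for all $a\in\mathcal{O}$, $k\in\mathbb{N}$, $\frac1N\#\{1\le n\le N:x_n\in D(a,q^{-k})\}\to q^{-k}$. Hausdorff dimension is with respect to the metric $|x-y|_\mathfrak{p}$. *)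

theory Defs
  imports "HOL-Analysis.Analysis"
begin

text \<open>A field 'a with a normalized non-Archimedean absolute value nv, discrete with value
group q^Z (q = size of the residue field O/p, q >= 2), complete, and of characteristic 0.
Such (F, |.|_p) are exactly the finite extensions of Q_p with their normalized absolute value.\<close>

definition local_field_char0 :: "('a::field \<Rightarrow> real) \<Rightarrow> nat \<Rightarrow> bool" where
  "local_field_char0 nv q \<longleftrightarrow>
     (\<forall>x. 0 \<le> nv x) \<and> (\<forall>x. nv x = 0 \<longleftrightarrow> x = 0) \<and>
     (\<forall>x y. nv (x * y) = nv x * nv y) \<and>
     (\<forall>x y. nv (x + y) \<le> max (nv x) (nv y)) \<and>
     (\<forall>x. x \<noteq> 0 \<longrightarrow> (\<exists>k::int. nv x = real q powi k)) \<and>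
     (\<exists>p. nv p = 1 / real q) \<and>
     2 \<le> q \<and>
     card ((\<lambda>x. {y. nv y \<le> 1 \<and> nv (y - x) < 1}) ` {x. nv x \<le> 1}) = q \<and>
     (\<forall>s::nat \<Rightarrow> 'a. (\<forall>e>0. \<exists>N. \<forall>m\<ge>N. \<forall>n\<ge>N. nv (s m - s n) < e) \<longrightarrow>
        (\<exists>L. \<forall>e>0. \<exists>N. \<forall>n\<ge>N. nv (s n - L) < e)) \<and>
     (\<forall>n::nat. n > 0 \<longrightarrow> of_nat n \<noteq> (0::'a))"

text \<open>The integral part [x]: if x = sum_{n>=v} c_n pi^n with digits c_n in C, then
[x] = sum_{n>=0} c_n pi^n, i.e. the unique element y of O such that x - y is a finite
sum sum_{n=1}^N c_n pi^(-n) with digits in C.\<close>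

definition intpart :: "('a::field \<Rightarrow> real) \<Rightarrow> 'a set \<Rightarrow> 'a \<Rightarrow> 'a \<Rightarrow> 'a" where
  "intpart nv C p x = (THE y. nv y \<le> 1 \<and>
      (\<exists>N c. (\<forall>n. c n \<in> C) \<and> x - y = (\<Sum>n=1..N. c n * inverse p ^ n)))"

definition unif_distributed :: "('a::field \<Rightarrow> real) \<Rightarrow> nat \<Rightarrow> (nat \<Rightarrow> 'a) \<Rightarrow> bool" where
  "unif_distributed nv q s \<longleftrightarrow>
     (\<forall>n\<ge>1. nv (s n) \<le> 1) \<and>
     (\<forall>a k::nat. nv a \<le> 1 \<longrightarrow>
        (\<lambda>N. real (card {n \<in> {1..N}. nv (s n - a) \<le> real q powi (- int k)}) / real N)
          \<longlonglongrightarrow> real q powi (- int k))"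

definition mdiam :: "('a \<Rightarrow> 'a \<Rightarrow> real) \<Rightarrow> 'a set \<Rightarrow> real" where
  "mdiam d U = (if U = {} then 0 else (SUP x\<in>U. SUP y\<in>U. d x y))"

definition hausdorff_pre :: "('a \<Rightarrow> 'a \<Rightarrow> real) \<Rightarrow> real \<Rightarrow> real \<Rightarrow> 'a set \<Rightarrow> ennreal" where
  "hausdorff_pre d s \<delta> E = (INF U \<in> {U::nat \<Rightarrow> 'a set. E \<subseteq> (\<Union>i. U i) \<and>
        (\<forall>i. \<forall>x\<in>U i. \<forall>y\<in>U i. d x y \<le> \<delta>)}.
      (\<Sum>i. ennreal (mdiam d (U i) powr s)))"

definition hausdorff_measure :: "('a \<Rightarrow> 'a \<Rightarrow> real) \<Rightarrow> real \<Rightarrow> 'a set \<Rightarrow> ennreal" where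
  "hausdorff_measure d s E = (SUP \<delta> \<in> {0<..}. hausdorff_pre d s \<delta> E)"

definition hausdorff_dim :: "('a \<Rightarrow> 'a \<Rightarrow> real) \<Rightarrow> 'a set \<Rightarrow> ereal" where
  "hausdorff_dim d E = Inf (ereal ` {s. 0 < s \<and> hausdorff_measure d s E = 0})"

end

theory Submission
  imports Defs
begin

text \<open>
  The upper bound holds for every set, since a ball of radius \<open>q ^ j\<close> splits into \<open>q ^ (j + k)\<close> balls
  of radius \<open>q powi (- k)\<close>. For the lower bound fix \<open>m\<close> and build a Cantor set of points \<open>x\<close> with
  \<open>\<bar>x\<bar> = q ^ m\<close>. Choose \<open>M > q\<close> such that \<open>\<bar>n\<bar>\<close> is bounded below for all \<open>n\<close> not divisible by \<open>M\<close>;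
  this needs characteristic 0. For such \<open>n\<close> the map \<open>\<lambda>x. \<alpha> * x ^ n\<close> is a similarity of small balls, so
  splitting a ball into \<open>q ^ m\<close> smaller ones and discarding those on which
  \<open>[\<alpha> * x ^ n]\<close> lies in the maximal ideal keeps at least \<open>q ^ m - q ^ (m - 1)\<close> of them. The resulting set has
  dimension at least \<open>1 - 1 / m\<close>, and for its points the frequency of visits to the maximal
  ideal is at most \<open>1 / M < 1 / q\<close>.
\<close>

section \<open>Hausdorff measures and trees of balls\<close>

text \<open>The real suprema in \<open>mdiam\<close> are meaningful only for bounded families; the
  bound \<open>B\<close> makes both the inner and the outer family bounded above.\<close>

lemma le_mdiam:
  assumes "\<And>x y. x \<in> U \<Longrightarrow> y \<in> U \<Longrightarrow> d x y \<le> (B::real)" "x \<in> U" "y \<in> U"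
  shows "d x y \<le> mdiam d U"
proof -
  have "(SUP y\<in>U. d u y) \<le> B" if "u \<in> U" for u
    using assms that by (intro cSUP_least) auto
  then have bdd: "bdd_above ((\<lambda>x. SUP y\<in>U. d x y) ` U)"
    by (auto simp: bdd_above_def)
  have "d x y \<le> (SUP y\<in>U. d x y)"
    using assms by (intro cSUP_upper) (auto simp: bdd_above_def)
  also have "\<dots> \<le> (SUP x\<in>U. SUP y\<in>U. d x y)"
    by (rule cSUP_upper[OF \<open>x \<in> U\<close> bdd])
  finally show ?thesis using assms(2) by (auto simp: mdiam_def)
qed

lemma mdiam_le:
  assumes "\<And>x y. x \<in> U \<Longrightarrow> y \<in> U \<Longrightarrow> d x y \<le> (B::real)" "0 \<le> B"
  shows "mdiam d U \<le> B"
  using assms by (auto simp: mdiam_def intro!: cSUP_least)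

lemma mdiam_nonneg:
  assumes "\<And>x y. x \<in> U \<Longrightarrow> y \<in> U \<Longrightarrow> d x y \<le> (B::real)" "\<And>x y. 0 \<le> d x y"
  shows "0 \<le> mdiam d U"
proof (cases "U = {}")
  case False
  then obtain x where "x \<in> U" by auto
  then have "d x x \<le> mdiam d U" using assms(1) by (intro le_mdiam)
  then show ?thesis using assms(2)[of x x] by linarith
qed (simp add: mdiam_def)

text \<open>Take the largest \<open>t\<close> with \<open>D \<le> R / Q ^ t\<close>; then
  \<open>R / Q ^ Suc t < D\<close>, which gives the cost bound. For \<open>D = 0\<close> there is no
  largest \<open>t\<close>, and the slack \<open>e\<close> absorbs the cost of a deep level. This
  assigns to each set of a cover a level of the tree.\<close>

lemma cover_level:
  fixes R Q s D e :: real
  assumes "R > 0" "Q > 1" "s > 0" "0 \<le> D" "D \<le> R" "e > 0"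
  shows "\<exists>t. D \<le> R / Q ^ t \<and> 1 / (Q powr s) ^ t \<le> (Q / R) powr s * D powr s + e"
proof (cases "D = 0")
  case True
  have "Q powr s > 1" using assms by simp
  then obtain t where "(1 / (Q powr s)) ^ t < e"
    using real_arch_pow_inv[of e "1 / (Q powr s)"] assms by auto
  then show ?thesis using True assms by (intro exI[of _ t]) (auto simp: power_one_over)
next
  case False
  then have D: "D > 0" using assms by simp
  define P where "P \<equiv> \<lambda>t. R / Q ^ t < D"
  obtain n where "(1 / Q) ^ n < D / R"
    using real_arch_pow_inv[of "D / R" "1 / Q"] assms D by auto
  then have "P n" using assms by (simp add: P_def field_simps)
  moreover have "\<not> P 0" using assms by (simp add: P_def)
  ultimately obtain t where t: "\<not> P t" "P (Suc t)"
    using nat_induct[of "\<lambda>t. \<not> P t" n] by blast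
  have "1 / (Q powr s) ^ t = (Q / R) powr s * (R / Q ^ Suc t) powr s"
  proof -
    have "(Q / R) powr s * (R / Q ^ Suc t) powr s = ((Q / R) * (R / Q ^ Suc t)) powr s"
      using assms by (subst powr_mult) auto
    also have "(Q / R) * (R / Q ^ Suc t) = 1 / Q ^ t" using assms by simp
    also have "(1 / Q ^ t) powr s = 1 / (Q powr s) ^ t"
      using assms by (simp add: powr_divide powr_realpow[symmetric] powr_powr mult.commute)
    finally show ?thesis by simp
  qed
  also have "\<dots> \<le> (Q / R) powr s * D powr s"
    using t assms by (intro mult_left_mono powr_mono2) (auto simp: P_def)
  finally show ?thesis using t assms by (intro exI[of _ t]) (auto simp: P_def)
qed

text \<open>
  A lower bound for Hausdorff dimension without measures: against a cheap cover, one descends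
  greedily into a child whose share of the cost is below average, and the limit point is missed.
\<close>

lemma hausdorff_measure_tree_nonzero:
  fixes d :: "'a \<Rightarrow> 'a \<Rightarrow> real" and P :: "nat \<Rightarrow> 'a \<Rightarrow> bool" and R Q s :: real
  assumes sym: "\<And>x y. d x y = d y x" and nonneg: "\<And>x y. 0 \<le> d x y" 
    and ultra: "\<And>x y z. d x z \<le> max (d x y) (d y z)"
    and complete: "\<And>X :: nat \<Rightarrow> 'a. (\<forall>e>0. \<exists>N. \<forall>m\<ge>N. \<forall>n\<ge>N. d (X m) (X n) < e) \<Longrightarrow>
        \<exists>L. \<forall>e>0. \<exists>N. \<forall>n\<ge>N. d (X n) L < e"
    and R: "R > 0" and Q: "Q > 1" and s: "s > 0"
    and root: "P 0 x\<^sub>0"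
    and children: "\<And>t x. P t x \<Longrightarrow> \<exists>A. finite A \<and> Q powr s \<le> card A \<and>
        (\<forall>a\<in>A. P (Suc t) a \<and> d a x \<le> R / Q ^ t) \<and>
        (\<forall>a\<in>A. \<forall>b\<in>A. a \<noteq> b \<longrightarrow> R / Q ^ Suc t < d a b)"
    and limit: "\<And>X L. (\<And>t. P t (X t) \<and> d L (X t) \<le> R / Q ^ t) \<Longrightarrow> L \<in> E"
  shows "hausdorff_measure d s E \<noteq> 0"
proof
  assume "hausdorff_measure d s E = 0"
  moreover have "hausdorff_pre d s R E \<le> hausdorff_measure d s E"
    unfolding hausdorff_measure_def using R by (intro SUP_upper) auto
  \<comment> \<open>Scaled by \<open>(Q / R) powr s\<close> this threshold becomes
    \<open>1 / 2\<close>; the slacks \<open>(1/2)^(i+2)\<close> below sum to the other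
    \<open>1 / 2\<close>, so the total stays below the budget 1 of the root.\<close>
  ultimately have "hausdorff_pre d s R E < ennreal ((R / Q) powr s / 2)"
    using R Q by (auto simp: ennreal_zero_less_divide)
  then obtain U where cov: "E \<subseteq> (\<Union>i. U i)"
    and small: "\<And>i x y. x \<in> U i \<Longrightarrow> y \<in> U i \<Longrightarrow> d x y \<le> R"
    and cost: "(\<Sum>i. ennreal (mdiam d (U i) powr s)) < ennreal ((R / Q) powr s / 2)"
    by (auto simp: hausdorff_pre_def INF_less_iff)
  define K where "K = Q powr s"
  have K: "K > 1" using Q s by (simp add: K_def)
  have md: "0 \<le> mdiam d (U i)" "mdiam d (U i) \<le> R" for i
  proof -
    show "mdiam d (U i) \<le> R" using small R by (intro mdiam_le) auto
    show "0 \<le> mdiam d (U i)" using small nonneg by (intro mdiam_nonneg[where B = R])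
  qed
  have "\<exists>t. mdiam d (U i) \<le> R / Q ^ t \<and>
      1 / K ^ t \<le> (Q / R) powr s * mdiam d (U i) powr s + (1/2)^(i+2)" for i
    unfolding K_def using md R Q s by (intro cover_level) auto
  then obtain T where T: "\<And>i. mdiam d (U i) \<le> R / Q ^ T i"
    "\<And>i. 1 / K ^ T i \<le> (Q / R) powr s * mdiam d (U i) powr s + (1/2)^(i+2)"
    by metis
  have T1: "d x y \<le> R / Q ^ T i" if "x \<in> U i" "y \<in> U i" for i x y
    using le_mdiam[of "U i" d R x y] small that T(1)[of i] by force
  have total: "(\<Sum>i. ennreal (1 / K ^ T i)) < 1"
  proof -
    have sums: "(\<lambda>i. (1/2::real)^(i+2)) sums (1/2)"
      using sums_mult[OF geometric_sums[of "1/2::real"], of "1/4"] by (simp add: power_add)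
    have "(\<Sum>i. ennreal (1 / K ^ T i)) \<le>
       (\<Sum>i. ennreal ((Q / R) powr s) * ennreal (mdiam d (U i) powr s) + ennreal ((1/2)^(i+2)))"
      using T(2) by (intro suminf_le)
        (auto simp: ennreal_mult[symmetric] ennreal_plus[symmetric] simp del: ennreal_plus intro!: ennreal_leI)
    also have "\<dots> = ennreal ((Q / R) powr s) * (\<Sum>i. ennreal (mdiam d (U i) powr s)) +
        (\<Sum>i. ennreal ((1/2)^(i+2)))"
      by (subst suminf_add[symmetric]) auto
    also have "(\<Sum>i. ennreal ((1/2)^(i+2))) = ennreal (1/2)"
      using sums by (intro suminf_ennreal_eq) auto
    also have "ennreal ((Q / R) powr s) * (\<Sum>i. ennreal (mdiam d (U i) powr s)) <
        ennreal ((Q / R) powr s) * ennreal ((R / Q) powr s / 2)"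
      using cost R Q by (intro ennreal_mult_strict_left_mono) auto
    also have "\<dots> = ennreal (1/2)"
      using R Q by (simp add: ennreal_mult[symmetric] powr_mult[symmetric])
    finally have "(\<Sum>i. ennreal (1 / K ^ T i)) < ennreal (1/2) + ennreal (1/2)" by simp
    also have "\<dots> = ennreal (1/2 + 1/2)" by (rule ennreal_plus[symmetric]) auto
    finally show ?thesis by simp
  qed
  \<comment> \<open>\<open>W t x\<close> is the cost charged to the ball of radius
    \<open>R / Q ^ t\<close> about \<open>x\<close>: a cover set counts while its level is at least
    \<open>t\<close> and it meets that ball. The invariant of the descent is that this charge stays
    below \<open>1 / K ^ t\<close>.\<close>
  define g where "g \<equiv> \<lambda>t x i. if t \<le> T i \<and> (\<exists>u\<in>U i. d u x \<le> R / Q ^ t)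
      then ennreal (1 / K ^ T i) else 0"
  define W where "W \<equiv> \<lambda>t x. \<Sum>i. g t x i"
  have step: "\<exists>y. (P (Suc t) y \<and> W (Suc t) y < ennreal (1 / K ^ Suc t)) \<and> d y x \<le> R / Q ^ t"
    if x: "P t x \<and> W t x < ennreal (1 / K ^ t)" for t x
  proof (rule ccontr)
    assume neg: "\<not> ?thesis"
    obtain A where A0: "finite A \<and> Q powr s \<le> card A \<and>
        (\<forall>a\<in>A. P (Suc t) a \<and> d a x \<le> R / Q ^ t) \<and>
        (\<forall>a\<in>A. \<forall>b\<in>A. a \<noteq> b \<longrightarrow> R / Q ^ Suc t < d a b)"
      using children[OF conjunct1[OF x]] ..
    have A: "finite A" "K \<le> card A"
      "\<And>a. a \<in> A \<Longrightarrow> P (Suc t) a" "\<And>a. a \<in> A \<Longrightarrow> d a x \<le> R / Q ^ t"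
      "\<And>a b. a \<in> A \<Longrightarrow> b \<in> A \<Longrightarrow> a \<noteq> b \<Longrightarrow> R / Q ^ Suc t < d a b"
      using A0 unfolding K_def by simp_all
    have mono: "R / Q ^ n \<le> R / Q ^ m" if "m \<le> n" for m n
      using that R Q by (intro divide_left_mono mult_pos_pos power_increasing) auto
    \<comment> \<open>A cover set with \<open>Suc t \<le> T i\<close> has diameter at most
      \<open>R / Q ^ Suc t\<close>, so by the separation of the children it is charged to at most
      one of them.\<close>
    have one: "(\<Sum>a\<in>A. g (Suc t) a i) \<le> g t x i" for i
    proof (cases "\<exists>a\<in>A. g (Suc t) a i \<noteq> 0")
      case True
      then obtain a where a: "a \<in> A" "g (Suc t) a i \<noteq> 0" by auto
      then obtain u where u: "Suc t \<le> T i" "u \<in> U i" "d u a \<le> R / Q ^ Suc t"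
        by (auto simp: g_def split: if_splits)
      have "g (Suc t) b i = 0" if "b \<in> A - {a}" for b
      proof (rule ccontr)
        assume "g (Suc t) b i \<noteq> 0"
        then obtain v where v: "v \<in> U i" "d v b \<le> R / Q ^ Suc t"
          by (auto simp: g_def split: if_splits)
        have "d u v \<le> R / Q ^ Suc t" using T1[OF u(2) v(1)] mono[OF u(1)] by simp
        then have "d a b \<le> R / Q ^ Suc t"
          using ultra[of a b u] ultra[of u b v] u v sym[of a u] by linarith
        then show False using A(5)[of a b] that a by auto
      qed
      then have "(\<Sum>a\<in>A. g (Suc t) a i) = g (Suc t) a i"
        using A(1) a(1) by (simp add: sum.remove)
      also have "\<dots> \<le> g t x i"
      proof -
        have "d u x \<le> R / Q ^ t"
          using ultra[of u x a] u(3) mono[of t "Suc t"] A(4)[OF a(1)] by linarith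
        then show ?thesis using u a by (auto simp: g_def)
      qed
      finally show ?thesis .
    qed simp
    \<comment> \<open>If every child carried at least \<open>1 / K ^ Suc t\<close>, the children, at
      least \<open>K\<close> in number, would exhaust the budget of \<open>x\<close>.\<close>
    have "ennreal (1 / K ^ t) \<le> ennreal (card A * (1 / K ^ Suc t))"
      using A(2) K by (intro ennreal_leI) (simp add: field_simps)
    also have "\<dots> = (\<Sum>a\<in>A. ennreal (1 / K ^ Suc t))"
      using K by (subst sum_ennreal) auto
    also have "\<dots> \<le> (\<Sum>a\<in>A. W (Suc t) a)"
      using neg A(3,4) by (intro sum_mono) force
    also have "\<dots> = (\<Sum>i. \<Sum>a\<in>A. g (Suc t) a i)"
      unfolding W_def by (subst suminf_sum) auto
    also have "\<dots> \<le> W t x"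
      unfolding W_def using one by (intro suminf_le) auto
    finally show False using x leD by blast
  qed
  have "W 0 x\<^sub>0 \<le> (\<Sum>i. ennreal (1 / K ^ T i))"
    unfolding W_def by (intro suminf_le) (auto simp: g_def)
  then have "P 0 x\<^sub>0 \<and> W 0 x\<^sub>0 < ennreal (1 / K ^ 0)" using total root by simp
  then obtain X where X: "\<And>t. P t (X t)" "\<And>t. W t (X t) < ennreal (1 / K ^ t)"
    "\<And>t. d (X (Suc t)) (X t) \<le> R / Q ^ t"
    using dependent_nat_choice[of "\<lambda>t x. P t x \<and> W t x < ennreal (1 / K ^ t)"
        "\<lambda>t x y. d y x \<le> R / Q ^ t"] step by metis
  have Xd: "d (X (t + k)) (X t) \<le> R / Q ^ t" for t k
  proof (induction k)
    case 0
    show ?case using ultra[of "X t" "X t" "X (Suc t)"] X(3)[of t] sym[of "X t" "X (Suc t)"] by simp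
  next
    case (Suc k)
    have "R / Q ^ (t + k) \<le> R / Q ^ t"
      using R Q by (intro divide_left_mono mult_pos_pos power_increasing) auto
    then show ?case using ultra[of "X (t + Suc k)" "X t" "X (t + k)"] X(3)[of "t+k"] Suc by simp
  qed
  have "\<exists>N. \<forall>m\<ge>N. \<forall>n\<ge>N. d (X m) (X n) < e" if e: "e > 0" for e
  proof -
    obtain N where "(1 / Q) ^ N < e / R"
      using real_arch_pow_inv[of "e / R" "1 / Q"] R Q e by auto
    then have N: "R / Q ^ N < e" using R Q by (simp add: field_simps)
    have "d (X m) (X n) < e" if "m \<ge> N" "n \<ge> N" for m n
      using ultra[of "X m" "X n" "X N"] Xd[of N "m - N"] Xd[of N "n - N"] that N
        sym[of "X N" "X n"] by simp
    then show ?thesis by blast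
  qed
  then have "\<forall>e>0. \<exists>N. \<forall>m\<ge>N. \<forall>n\<ge>N. d (X m) (X n) < e" by simp
  from complete[OF this] obtain L where L: "\<forall>e>0. \<exists>N. \<forall>n\<ge>N. d (X n) L < e" ..
  have LX: "d L (X t) \<le> R / Q ^ t" for t
  proof -
    obtain N where "\<forall>n\<ge>N. d (X n) L < R / Q ^ t" using L R Q by (meson divide_pos_pos less_trans zero_less_one zero_less_power)
    then have "d (X (t + N)) L < R / Q ^ t" by simp
    then show ?thesis using ultra[of L "X t" "X (t+N)"] Xd[of t N] sym[of L "X (t+N)"] by simp
  qed
  then have "L \<in> E" using X(1) by (intro limit conjI)
  then obtain i where i: "L \<in> U i" using cov by auto
  \<comment> \<open>At its own level \<open>T i\<close> the cover set containing \<open>L\<close> is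
    charged in full to the branch, and it alone uses up the budget
    \<open>1 / K ^ T i\<close>.\<close>
  have "ennreal (1 / K ^ T i) = g (T i) (X (T i)) i"
    using i LX[of "T i"] by (auto simp: g_def)
  also have "\<dots> = (\<Sum>j\<in>{i}. g (T i) (X (T i)) j)" by simp
  also have "\<dots> \<le> W (T i) (X (T i))"
    unfolding W_def by (intro sum_le_suminf) auto
  finally show False using X(2)[of "T i"] leD by blast
qed

section \<open>Discretely valued fields with finite residue field\<close>

locale local_field_digits =
  fixes nv :: "'a::field \<Rightarrow> real" and q :: nat and C :: "'a set" and \<pi> :: 'a
  assumes field: "local_field_char0 nv q"
    and nv_uniformizer: "nv \<pi> = 1 / real q"
    and C_integral: "C \<subseteq> {x. nv x \<le> 1}" and zero_C: "0 \<in> C"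
    and ex1_digit: "\<forall>x. nv x \<le> 1 \<longrightarrow> (\<exists>!c. c \<in> C \<and> nv (x - c) < 1)"
begin

lemma nv_nonneg [simp]: "0 \<le> nv x"
  and nv_eq_0 [simp]: "nv x = 0 \<longleftrightarrow> x = 0"
  and nv_mult: "nv (x * y) = nv x * nv y"
  and nv_add_le: "nv (x + y) \<le> max (nv x) (nv y)"
  and nv_value: "x \<noteq> 0 \<Longrightarrow> \<exists>k::int. nv x = real q powi k"
  and q_ge_2: "2 \<le> q"
  and card_residues: "card ((\<lambda>x. {y. nv y \<le> 1 \<and> nv (y - x) < 1}) ` {x. nv x \<le> 1}) = q"
  and nv_complete: "\<forall>e>0. \<exists>N. \<forall>m\<ge>N. \<forall>n\<ge>N. nv (X m - X n) < e \<Longrightarrow>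
        \<exists>L. \<forall>e>0. \<exists>N. \<forall>n\<ge>N. nv (X n - L) < e"
  and char_0: "n > 0 \<Longrightarrow> of_nat n \<noteq> (0::'a)"
  for X :: "nat \<Rightarrow> 'a" and n :: nat
  using field unfolding local_field_char0_def by blast+

lemma nv_0 [simp]: "nv 0 = 0"
  by simp

lemma nv_pos [simp]: "0 < nv x \<longleftrightarrow> x \<noteq> 0"
  using nv_nonneg[of x] nv_eq_0[of x] by linarith

lemma nv_1 [simp]: "nv 1 = 1"
  using nv_mult[of 1 1] nv_eq_0[of 1] by simp

lemma nv_minus [simp]: "nv (- x) = nv x"
proof -
  have "nv (-1) * nv (-1) = 1" using nv_mult[of "-1" "-1"] by simp
  then have "nv (-1) = 1"
    using nv_nonneg[of "-1"] by (metis abs_of_nonneg mult_1 abs_1 power2_eq_square power2_eq_1_iff abs_minus)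
  then show ?thesis using nv_mult[of "-1" x] by simp
qed

lemma nv_diff_commute: "nv (x - y) = nv (y - x)"
  using nv_minus[of "x - y"] by simp

lemma nv_diff_le: "nv (x - y) \<le> max (nv x) (nv y)"
  using nv_add_le[of x "- y"] by simp

lemma nv_diff_ultra: "nv (x - z) \<le> max (nv (x - y)) (nv (y - z))"
  using nv_add_le[of "x - y" "y - z"] by simp

lemma nv_add_eq: "nv y < nv x \<Longrightarrow> nv (x + y) = nv x"
  using nv_add_le[of x y] nv_diff_le[of "x + y" y] by auto

lemma nv_power: "nv (x ^ n) = nv x ^ n"
  by (induction n) (auto simp: nv_mult)

lemma nv_inverse: "nv (inverse x) = inverse (nv x)"
proof (cases "x = 0")
  case False
  then have "nv x * nv (inverse x) = 1" by (simp flip: nv_mult)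
  then show ?thesis by (metis inverse_unique)
qed simp

lemma nv_power_int: "nv (x powi k) = nv x powi k"
  by (auto simp: power_int_def nv_power nv_inverse)

lemma nv_sum_le:
  assumes "\<And>i. i \<in> A \<Longrightarrow> nv (f i) \<le> B" "0 \<le> B"
  shows "nv (sum f A) \<le> B"
  using assms(1)
proof (induction A rule: infinite_finite_induct)
  case (insert a A)
  then show ?case using nv_add_le[of "f a" "sum f A"] by (force simp: max_def split: if_splits)
qed (use \<open>0 \<le> B\<close> in auto)

lemma q_gt: "real q > 1" "real q > 0" "real q \<noteq> 0"
  using q_ge_2 by auto

lemma uniformizer_nonzero: "\<pi> \<noteq> 0"
  using nv_uniformizer q_gt by (metis divide_eq_0_iff nv_0 zero_neq_one)

lemma nv_uniformizer_powi: "nv (\<pi> powi k) = real q powi (- k)"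
  by (simp add: nv_power_int nv_uniformizer power_int_minus power_int_divide_distrib divide_inverse
      flip: power_int_inverse)

lemma q_powi_less_iff: "real q powi i < real q powi j \<longleftrightarrow> i < j"
  using q_gt by (metis linorder_not_le not_less power_int_increasing power_int_strict_increasing less_imp_le)

lemma q_powi_le_iff: "real q powi i \<le> real q powi j \<longleftrightarrow> i \<le> j"
  using q_powi_less_iff by (meson linorder_not_le)

lemma q_powi_pos: "0 < real q powi i"
  using q_gt by simp

lemma q_powi_add: "real q powi (i + j) = real q powi i * real q powi j"
  using q_gt by (simp add: power_int_add)

lemma q_power_powi: "(real q) ^ m = real q powi (int m)"
  by simp

text \<open>No value lies strictly between neighbouring powers of \<open>q\<close>, so a strict
  inequality gains a whole level.\<close>

lemma nv_discrete: "nv x < real q powi k \<Longrightarrow> nv x \<le> real q powi (k - 1)"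
  using nv_value[of x] q_powi_pos[of "k-1"] 
  by (cases "x = 0") (auto simp: q_powi_less_iff q_powi_le_iff)

lemma nv_of_nat_le: "nv (of_nat n) \<le> 1"
proof (induction n)
  case (Suc n)
  then show ?case using nv_add_le[of 1 "of_nat n"] by simp
qed simp

section \<open>Digits as representatives of residue classes\<close>

lemma nv_digit: "c \<in> C \<Longrightarrow> nv c \<le> 1"
  using C_integral by auto

lemma nv_digit_diff:
  assumes "c \<in> C" "c' \<in> C" "nv (c - c') < 1"
  shows "c = c'"
  using ex1_digit[rule_format, OF nv_digit[OF assms(1)]] assms by (metis diff_self nv_0 zero_less_one)

lemma nv_digit_diff_eq:
  assumes "c \<in> C" "c' \<in> C" "c \<noteq> c'"
  shows "nv (c - c') = 1"
proof -
  have "nv (c - c') \<le> 1"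
    using nv_diff_le[of c c'] nv_digit[OF assms(1)] nv_digit[OF assms(2)] by simp
  moreover have "\<not> nv (c - c') < 1" using nv_digit_diff[OF assms(1,2)] assms(3) by blast
  ultimately show ?thesis by simp
qed

definition digit :: "'a \<Rightarrow> 'a" where
  "digit x = (THE c. c \<in> C \<and> nv (x - c) < 1)"

lemma digit:
  assumes "nv x \<le> 1"
  shows "digit x \<in> C" "nv (x - digit x) < 1"
  using theI'[OF ex1_digit[rule_format, OF assms]] by (auto simp: digit_def)

text \<open>A residue class depends only on the digit of its members, and distinct digits lie in
  distinct classes; so the classes counted in \<open>local_field_char0\<close> correspond to
  \<open>C\<close>.\<close>

lemma finite_C: "finite C" and card_C: "card C = q"
proof -
  let ?f = "\<lambda>x. {y. nv y \<le> 1 \<and> nv (y - x) < 1}"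
  have "?f x = ?f (digit x)" if "nv x \<le> 1" for x
  proof -
    have "nv (y - x) < 1 \<longleftrightarrow> nv (y - digit x) < 1" for y
      using nv_diff_ultra[of y x "digit x"] nv_diff_ultra[of y "digit x" x] digit(2)[OF that]
        nv_diff_commute[of x "digit x"] by force
    then show ?thesis by simp
  qed
  then have "?f ` {x. nv x \<le> 1} = ?f ` C"
    using digit(1) C_integral by (auto simp: image_iff) blast+
  moreover have "inj_on ?f C"
  proof (rule inj_onI)
    fix c c' assume c: "c \<in> C" "c' \<in> C" and eq: "?f c = ?f c'"
    have "nv (c - c') < 1" using eqset_imp_iff[OF eq, of c] nv_digit[OF c(1)] by simp
    then show "c = c'" using nv_digit_diff[OF c] by simp
  qed
  ultimately show "card C = q" using card_residues card_image[of ?f C] by (simp only:)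
  then show "finite C" using q_ge_2 by (intro card_ge_0_finite) simp
qed

section \<open>Counting separated points in a ball\<close>

text \<open>The leading digit splits a ball into \<open>q\<close> balls whose radius is smaller by
  the factor \<open>q\<close>; the count follows by induction on the number of levels.\<close>

lemma card_spaced_le:
  assumes "finite A"
    and "\<And>a b. a \<in> A \<Longrightarrow> b \<in> A \<Longrightarrow> nv (a - b) \<le> real q powi e"
    and "\<And>a b. a \<in> A \<Longrightarrow> b \<in> A \<Longrightarrow> a \<noteq> b \<Longrightarrow> real q powi (e - int n) < nv (a - b)"
  shows "card A \<le> q ^ n"
  using assms
proof (induction n arbitrary: A e)
  case 0
  then have "a = b" if "a \<in> A" "b \<in> A" for a b using that by force
  then have "A = {} \<or> (\<exists>a. A = {a})" by blast
  then show ?case by auto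
next
  case (Suc n)
  show ?case
  proof (cases "A = {}")
    case False
    then obtain a\<^sub>0 where a0: "a\<^sub>0 \<in> A" by auto
    \<comment> \<open>Scaling by \<open>\<pi> powi e\<close> moves the ball of radius
      \<open>real q powi e\<close> about \<open>a\<^sub>0\<close> onto the valuation ring, where the
      digit selects a subball.\<close>
    define f where "f z = digit ((z - a\<^sub>0) * \<pi> powi e)" for z
    have scale: "nv (z * \<pi> powi e) \<le> real q powi i \<longleftrightarrow> nv z \<le> real q powi (e + i)" for z i
      using q_powi_pos[of e] 
      by (simp add: nv_mult nv_uniformizer_powi q_powi_add power_int_minus field_simps)
    have unit: "nv ((z - a\<^sub>0) * \<pi> powi e) \<le> 1" if "z \<in> A" for z
      using scale[of "z - a\<^sub>0" 0] Suc.prems(2)[OF that a0] by simp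
    have fib: "card {z \<in> A. f z = c} \<le> q ^ n" for c
    proof (rule Suc.IH[of _ "e - 1"])
      fix a b assume a: "a \<in> {z \<in> A. f z = c}" and b: "b \<in> {z \<in> A. f z = c}"
      have "nv ((a - a\<^sub>0) * \<pi> powi e - (b - a\<^sub>0) * \<pi> powi e) < 1"
        using nv_diff_ultra[of "(a - a\<^sub>0) * \<pi> powi e" "(b - a\<^sub>0) * \<pi> powi e" c]
          digit(2)[OF unit[of a]] digit(2)[OF unit[of b]] a b nv_diff_commute[of c]
        by (auto simp: f_def)
      then have "nv ((a - b) * \<pi> powi e) < real q powi 0" by (simp add: algebra_simps)
      then show "nv (a - b) \<le> real q powi (e - 1)"
        using nv_discrete[of "(a - b) * \<pi> powi e" 0] scale[of "a - b" "-1"] by simp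
      assume "a \<noteq> b"
      then show "real q powi (e - 1 - int n) < nv (a - b)"
        using Suc.prems(3)[of a b] a b by (simp add: algebra_simps)
    qed (use Suc.prems in auto)
    have "A = (\<Union>c\<in>C. {z \<in> A. f z = c})"
      using digit(1)[OF unit] by (auto simp: f_def)
    then have "card A \<le> (\<Sum>c\<in>C. card {z \<in> A. f z = c})"
      using card_UN_le[OF finite_C, of "\<lambda>c. {z \<in> A. f z = c}"] by simp
    also have "\<dots> \<le> (\<Sum>c\<in>C. q ^ n)" using fib by (intro sum_mono)
    also have "\<dots> = q ^ Suc n" by (simp add: card_C)
    finally show ?thesis .
  qed simp
qed

text \<open>Appending one more digit multiplies the number of points by \<open>q\<close>, so the
  bound of \<open>card_spaced_le\<close> is attained.\<close>

lemma ex_spaced: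
  "\<exists>S. finite S \<and> card S = q ^ n \<and> (\<forall>a\<in>S. nv a \<le> real q powi e) \<and>
     (\<forall>a\<in>S. \<forall>b\<in>S. a \<noteq> b \<longrightarrow> real q powi (e - int n) < nv (a - b))"
proof (induction n)
  case 0
  show ?case using q_powi_pos[of e] by (intro exI[of _ "{0}"]) auto
next
  case (Suc n)
  then obtain S where "finite S \<and> card S = q ^ n \<and> (\<forall>a\<in>S. nv a \<le> real q powi e) \<and>
     (\<forall>a\<in>S. \<forall>b\<in>S. a \<noteq> b \<longrightarrow> real q powi (e - int n) < nv (a - b))" ..
  then have S: "finite S" "card S = q ^ n" "\<And>a. a \<in> S \<Longrightarrow> nv a \<le> real q powi e"
    "\<And>a b. a \<in> S \<Longrightarrow> b \<in> S \<Longrightarrow> a \<noteq> b \<Longrightarrow> real q powi (e - int n) < nv (a - b)"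
    by simp_all
  \<comment> \<open>The new digit has size at most \<open>real q powi (e - int n)\<close>, below the
    old distances: it separates points with equal \<open>s\<close> and leaves the other distances
    unchanged.\<close>
  define g where "g \<equiv> \<lambda>(s, c). s + \<pi> powi (int n - e) * c"
  have shift: "nv (\<pi> powi (int n - e) * c) = real q powi (e - int n) * nv c" for c
    by (simp add: nv_mult nv_uniformizer_powi)
  have lt: "real q powi (e - int (Suc n)) < real q powi (e - int n)"
    by (simp add: q_powi_less_iff)
  have dist: "real q powi (e - int (Suc n)) < nv (g x - g y)"
    if "x \<in> S \<times> C" "y \<in> S \<times> C" "x \<noteq> y" for x y
  proof -
    obtain s c s' c' where xy: "x = (s, c)" "y = (s', c')" by (cases x, cases y)
    have eq: "g x - g y = (s - s') + \<pi> powi (int n - e) * (c - c')"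
      by (simp add: g_def xy algebra_simps)
    show ?thesis
    proof (cases "s = s'")
      case True
      then have "nv (g x - g y) = real q powi (e - int n)"
        using eq nv_digit_diff_eq[of c c'] that xy by (simp add: shift)
      then show ?thesis using lt by simp
    next
      case False
      have "nv (c - c') \<le> 1" using nv_diff_le[of c c'] nv_digit[of c] nv_digit[of c'] that xy by auto
      then have "nv (\<pi> powi (int n - e) * (c - c')) \<le> real q powi (e - int n)"
        using q_powi_pos[of "e - int n"] by (simp add: shift mult_left_le)
      also have "\<dots> < nv (s - s')" using S(4) False that xy by auto
      finally have "nv (g x - g y) = nv (s - s')" using eq nv_add_eq by simp
      moreover have "real q powi (e - int n) < nv (s - s')" using S(4) False that xy by auto
      ultimately show ?thesis using lt by simp
    qed
  qed
  have "inj_on g (S \<times> C)"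
  proof (rule inj_onI, rule ccontr)
    fix x y assume "x \<in> S \<times> C" "y \<in> S \<times> C" "g x = g y" "x \<noteq> y"
    then show False using dist[of x y] q_powi_pos[of "e - int (Suc n)"] by simp
  qed
  then have "card (g ` (S \<times> C)) = q ^ Suc n"
    by (simp add: card_image card_cartesian_product S(2) card_C)
  moreover have "nv (g x) \<le> real q powi e" if x: "x \<in> S \<times> C" for x
  proof -
    obtain s c where sc: "x = (s, c)" by (cases x)
    have "nv (\<pi> powi (int n - e) * c) \<le> real q powi (e - int n)"
      using q_powi_pos[of "e - int n"] nv_digit[of c] x sc by (simp add: shift mult_left_le)
    also have "\<dots> \<le> real q powi e" by (simp add: q_powi_le_iff)
    finally show ?thesis
      using nv_add_le[of s "\<pi> powi (int n - e) * c"] S(3)[of s] x sc by (simp add: g_def)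
  qed
  moreover have "finite (g ` (S \<times> C))" using S(1) finite_C by simp
  moreover have "real q powi (e - int (Suc n)) < nv (a - b)"
    if "a \<in> g ` (S \<times> C)" "b \<in> g ` (S \<times> C)" "a \<noteq> b" for a b
    using that dist by blast
  ultimately show ?case by (intro exI[of _ "g ` (S \<times> C)"]) blast
qed

section \<open>Power maps on small balls\<close>

text \<open>Multiplying the expected bound \<open>nv (x - y) * nv y ^ (k - 1)\<close> through by
  \<open>nv y\<close> avoids the truncated exponent at \<open>k = 0\<close> and any
  division.\<close>

lemma nv_power_diff_le:
  assumes "nv x \<le> nv y"
  shows "nv (x ^ k - y ^ k) * nv y \<le> nv (x - y) * nv y ^ k"
proof (induction k)
  case (Suc k)
  have "x ^ Suc k - y ^ Suc k = x * (x ^ k - y ^ k) + (x - y) * y ^ k"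
    by (simp add: algebra_simps)
  then have "nv (x ^ Suc k - y ^ Suc k) \<le> max (nv x * nv (x ^ k - y ^ k)) (nv (x - y) * nv y ^ k)"
    using nv_add_le[of "x * (x ^ k - y ^ k)" "(x - y) * y ^ k"] by (simp add: nv_mult nv_power)
  moreover have "nv x * nv (x ^ k - y ^ k) * nv y \<le> nv y * (nv (x - y) * nv y ^ k)"
    using mult_mono[OF assms Suc.IH] by (simp add: mult.assoc)
  ultimately show ?case
    using mult_right_mono[of "nv (x ^ Suc k - y ^ Suc k)" _ "nv y"]
    by (fastforce simp: max_def mult_ac split: if_splits intro: order_trans)
qed simp

text \<open>The difference quotient is a sum of $n$ terms, each close to $y^{n-1}$.\<close>

lemma nv_power_diff_eq:
  assumes "nv (x - y) < nv (of_nat n) * nv y"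
  shows "nv (x ^ n - y ^ n) = nv (of_nat n) * nv y ^ (n - 1) * nv (x - y)"
proof (cases n)
  case 0
  then show ?thesis using assms by simp
next
  case (Suc m)
  have ypos: "nv y > 0" using assms nv_nonneg[of "x - y"] by (metis mult_zero_right not_less nv_eq_0 nv_pos)
  have "nv (of_nat n) * nv y \<le> nv y" using nv_of_nat_le[of n] by (simp add: mult_left_le_one_le)
  then have xy: "nv x \<le> nv y" using nv_add_le[of "x - y" y] assms by simp
  define S where "S = (\<Sum>p<Suc m. x ^ p * y ^ (m - p))"
  have "S - of_nat n * y ^ m = (\<Sum>p<Suc m. (x ^ p - y ^ p) * y ^ (m - p))"
    by (simp add: S_def left_diff_distrib sum_subtractf Suc flip: power_add)
  moreover have "nv (\<dots>) \<le> nv (x - y) * nv y ^ m / nv y"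
  proof (rule nv_sum_le)
    fix p assume p: "p \<in> {..<Suc m}"
    have "nv ((x ^ p - y ^ p) * y ^ (m - p)) * nv y = (nv (x ^ p - y ^ p) * nv y) * nv y ^ (m - p)"
      by (simp add: nv_mult nv_power)
    also have "\<dots> \<le> nv (x - y) * nv y ^ p * nv y ^ (m - p)"
      using nv_power_diff_le[OF xy] by (intro mult_right_mono) auto
    also have "\<dots> = nv (x - y) * nv y ^ m" using p by (simp flip: power_add)
    finally show "nv ((x ^ p - y ^ p) * y ^ (m - p)) \<le> nv (x - y) * nv y ^ m / nv y"
      using ypos by (simp add: field_simps)
  qed (use ypos in simp)
  ultimately have "nv (S - of_nat n * y ^ m) \<le> nv (x - y) * nv y ^ m / nv y" by simp
  \<comment> \<open>Here the hypothesis enters: the error is strictly smaller than the main term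
    \<open>of_nat n * y ^ m\<close>, so \<open>S\<close> inherits the absolute value of that
    term.\<close>
  also have "\<dots> < nv (of_nat n) * nv y * nv y ^ m / nv y"
    using ypos assms by (intro divide_strict_right_mono mult_strict_right_mono) auto
  also have "\<dots> = nv (of_nat n * y ^ m)" using ypos by (simp add: nv_mult nv_power)
  finally have "nv S = nv (of_nat n * y ^ m)"
    using nv_add_eq[of "S - of_nat n * y ^ m" "of_nat n * y ^ m"] by simp
  moreover have "x ^ n - y ^ n = (x - y) * S"
    unfolding Suc S_def by (rule diff_power_eq_sum)
  ultimately show ?thesis by (simp add: Suc nv_mult nv_power)
qed

section \<open>Integral parts\<close>

text \<open>The possible values of \<open>z - [z]\<close>. Membership in this set replaces the
  existential statement in \<open>intpart\<close>.\<close>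

definition frac_parts :: "'a set" where
  "frac_parts = {u. \<exists>N c. (\<forall>n. c n \<in> C) \<and> u = (\<Sum>n=1..N. c n * inverse \<pi> ^ n)}"

lemma nv_frac_term: "nv (c * inverse \<pi> ^ n) = nv c * real q ^ n"
  using q_gt by (simp add: nv_mult nv_power nv_inverse nv_uniformizer)

lemma nv_digit_sum_le:
  assumes "\<And>n. c n \<in> C"
  shows "nv (\<Sum>n=1..N. c n * inverse \<pi> ^ n) \<le> real q ^ N"
proof (rule nv_sum_le)
  fix n assume "n \<in> {1..N}"
  then show "nv (c n * inverse \<pi> ^ n) \<le> real q ^ N"
    using mult_mono[of "nv (c n)" 1 "real q ^ n" "real q ^ N"] nv_digit[OF assms[of n]] q_gt
    by (simp add: nv_frac_term power_increasing)
qed simp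

text \<open>If the top digits differed, their term would have absolute value
  \<open>real q ^ Suc N\<close>, while everything else is at most \<open>real q ^ N\<close>. So the
  top digits agree, and induction handles the rest.\<close>

lemma digit_sum_unique:
  assumes "\<And>n. c n \<in> C" "\<And>n. c' n \<in> C"
    and "nv ((\<Sum>n=1..N. c n * inverse \<pi> ^ n) - (\<Sum>n=1..N. c' n * inverse \<pi> ^ n)) \<le> 1"
  shows "(\<Sum>n=1..N. c n * inverse \<pi> ^ n) = (\<Sum>n=1..N. c' n * inverse \<pi> ^ n)"
  using assms(3)
proof (induction N)
  case (Suc N)
  let ?S = "\<lambda>c N. \<Sum>n=1..N. c n * inverse \<pi> ^ n"
  have split: "?S c (Suc N) = ?S c N + c (Suc N) * inverse \<pi> ^ Suc N" for c
    by simp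
  have diff: "(c (Suc N) - c' (Suc N)) * inverse \<pi> ^ Suc N =
      (?S c (Suc N) - ?S c' (Suc N)) - (?S c N - ?S c' N)"
    unfolding split by (simp add: algebra_simps)
  have "nv ((c (Suc N) - c' (Suc N)) * inverse \<pi> ^ Suc N) \<le>
      max (nv (?S c (Suc N) - ?S c' (Suc N))) (max (nv (?S c N)) (nv (?S c' N)))"
    unfolding diff by (rule order_trans[OF nv_diff_le max.mono[OF order_refl nv_diff_le]])
  also have "\<dots> \<le> real q ^ N"
    using assms(1,2) q_gt
    by (intro max.boundedI order_trans[OF Suc.prems one_le_power] nv_digit_sum_le) auto
  also have "\<dots> < real q ^ Suc N" using q_gt by simp
  finally have "nv (c (Suc N) - c' (Suc N)) < 1" using q_gt by (simp only: nv_frac_term) simp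
  then have eq: "c (Suc N) = c' (Suc N)" using nv_digit_diff assms by blast
  then show ?case using Suc unfolding split by simp
qed simp

lemma digit_sum_extend:
  assumes "\<forall>n. c n \<in> C" "N \<le> M"
  shows "\<exists>c'. (\<forall>n. c' n \<in> C) \<and>
    (\<Sum>n=1..N. c n * inverse \<pi> ^ n) = (\<Sum>n=1..M. c' n * inverse \<pi> ^ n)"
proof (intro exI conjI allI)
  let ?c = "\<lambda>n. if n \<le> N then c n else 0"
  show "?c n \<in> C" for n using assms zero_C by auto
  have "(\<Sum>n=1..M. ?c n * inverse \<pi> ^ n) = (\<Sum>n=1..N. ?c n * inverse \<pi> ^ n)"
    using assms(2) by (intro sum.mono_neutral_right) auto
  also have "\<dots> = (\<Sum>n=1..N. c n * inverse \<pi> ^ n)"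
    by (intro sum.cong) auto
  finally show "(\<Sum>n=1..N. c n * inverse \<pi> ^ n) = (\<Sum>n=1..M. ?c n * inverse \<pi> ^ n)" ..
qed

text \<open>Padding with zero digits gives both expansions the same length. The result makes
  \<open>intpart\<close> well defined and later shows that unequal fractional parts dominate
  distances.\<close>

lemma frac_parts_unique:
  assumes "u \<in> frac_parts" "v \<in> frac_parts" "nv (u - v) \<le> 1"
  shows "u = v"
proof -
  obtain N c where c: "\<forall>n. c n \<in> C" "u = (\<Sum>n=1..N. c n * inverse \<pi> ^ n)"
    using assms(1) by (auto simp: frac_parts_def)
  obtain N' c' where c': "\<forall>n. c' n \<in> C" "v = (\<Sum>n=1..N'. c' n * inverse \<pi> ^ n)"
    using assms(2) by (auto simp: frac_parts_def)
  obtain b where b: "(\<forall>n. b n \<in> C) \<and>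
      (\<Sum>n=1..N. c n * inverse \<pi> ^ n) = (\<Sum>n=1..max N N'. b n * inverse \<pi> ^ n)"
    using digit_sum_extend[of c N "max N N'", OF c(1) max.cobounded1] ..
  obtain b' where b': "(\<forall>n. b' n \<in> C) \<and>
      (\<Sum>n=1..N'. c' n * inverse \<pi> ^ n) = (\<Sum>n=1..max N N'. b' n * inverse \<pi> ^ n)"
    using digit_sum_extend[of c' N' "max N N'", OF c'(1) max.cobounded2] ..
  show ?thesis
    using digit_sum_unique[of b b' "max N N'"] assms(3)
    unfolding c(2) c'(2) conjunct2[OF b] conjunct2[OF b'] using b b' by blast
qed

text \<open>The digit of \<open>z * \<pi> ^ Suc N\<close> is the top digit of \<open>z\<close>;
  removing its term lowers the bound from \<open>real q ^ Suc N\<close> to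
  \<open>real q ^ N\<close>, until an integral element remains.\<close>

lemma frac_part_exists: "\<exists>u\<in>frac_parts. nv (z - u) \<le> 1"
proof -
  have "\<exists>c. (\<forall>n. c n \<in> C) \<and> nv (z - (\<Sum>n=1..N. c n * inverse \<pi> ^ n)) \<le> 1"
    if "nv z \<le> real q ^ N" for N z
    using that
  proof (induction N arbitrary: z)
    case 0
    then show ?case using zero_C by (intro exI[of _ "\<lambda>_. 0"]) auto
  next
    case (Suc N)
    let ?d = "digit (z * \<pi> ^ Suc N)"
    have "nv (z * \<pi> ^ Suc N) \<le> 1"
      using Suc.prems q_gt by (simp add: nv_mult nv_power nv_uniformizer power_divide field_simps)
    note d = digit[OF this]
    have one: "\<pi> ^ Suc N * inverse \<pi> ^ Suc N = 1"
      using uniformizer_nonzero by (metis power_mult_distrib power_one right_inverse)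
    have "z - ?d * inverse \<pi> ^ Suc N = (z * \<pi> ^ Suc N - ?d) * inverse \<pi> ^ Suc N"
      by (simp only: left_diff_distrib mult.assoc one mult_1_right)
    then have "nv (z - ?d * inverse \<pi> ^ Suc N) = nv (z * \<pi> ^ Suc N - ?d) * real q ^ Suc N"
      by (simp only: nv_frac_term)
    also have "\<dots> < real q powi int (Suc N)" using d(2) q_gt unfolding q_power_powi[symmetric] by simp
    finally have "nv (z - ?d * inverse \<pi> ^ Suc N) \<le> real q powi (int (Suc N) - 1)"
      by (rule nv_discrete)
    then have "nv (z - ?d * inverse \<pi> ^ Suc N) \<le> real q ^ N" by simp
    from Suc.IH[OF this] obtain c where c: "\<And>n. c n \<in> C"
      "nv (z - ?d * inverse \<pi> ^ Suc N - (\<Sum>n=1..N. c n * inverse \<pi> ^ n)) \<le> 1" by blast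
    let ?c = "c(Suc N := ?d)"
    have "(\<Sum>n=1..N. ?c n * inverse \<pi> ^ n) = (\<Sum>n=1..N. c n * inverse \<pi> ^ n)"
      by (intro sum.cong) auto
    then have eq: "z - (\<Sum>n=1..Suc N. ?c n * inverse \<pi> ^ n) =
        z - ?d * inverse \<pi> ^ Suc N - (\<Sum>n=1..N. c n * inverse \<pi> ^ n)"
      by (simp add: algebra_simps)
    then have "nv (z - (\<Sum>n=1..Suc N. ?c n * inverse \<pi> ^ n)) \<le> 1" using c(2) by (simp only: eq)
    moreover have "\<forall>n. ?c n \<in> C" using c(1) d(1) by simp
    ultimately show ?case by blast
  qed
  moreover obtain N where "nv z < real q ^ N" using real_arch_pow q_gt(1) by blast
  ultimately obtain c where "\<forall>n. c n \<in> C" "nv (z - (\<Sum>n=1..N. c n * inverse \<pi> ^ n)) \<le> 1"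
    by (meson less_imp_le)
  then show ?thesis by (auto simp: frac_parts_def)
qed

text \<open>The fractional parts belonging to two candidates differ by an integral element, hence
  coincide.\<close>

lemma intpart_eq:
  assumes "nv y \<le> 1" "z - y \<in> frac_parts"
  shows "intpart nv C \<pi> z = y"
  unfolding intpart_def
proof (rule the_equality)
  show "nv y \<le> 1 \<and> (\<exists>N c. (\<forall>n. c n \<in> C) \<and> z - y = (\<Sum>n=1..N. c n * inverse \<pi> ^ n))"
    using assms by (auto simp: frac_parts_def)
next
  fix y' assume "nv y' \<le> 1 \<and> (\<exists>N c. (\<forall>n. c n \<in> C) \<and> z - y' = (\<Sum>n=1..N. c n * inverse \<pi> ^ n))"
  then have y': "nv y' \<le> 1" "z - y' \<in> frac_parts" by (auto simp: frac_parts_def)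
  have "nv ((z - y') - (z - y)) \<le> 1" using nv_diff_le[of y y'] assms(1) y'(1) by simp
  from frac_parts_unique[OF y'(2) assms(2) this] show "y' = y" by simp
qed

lemma intpart: "nv (intpart nv C \<pi> z) \<le> 1" "z - intpart nv C \<pi> z \<in> frac_parts"
proof -
  obtain u where u: "u \<in> frac_parts" "nv (z - u) \<le> 1" using frac_part_exists by blast
  have "intpart nv C \<pi> z = z - u" using u by (intro intpart_eq) auto
  then show "nv (intpart nv C \<pi> z) \<le> 1" "z - intpart nv C \<pi> z \<in> frac_parts" using u by auto
qed

text \<open>The fractional part \<open>z - [z]\<close> serves for \<open>z + h\<close> as well. This
  transfers conditions on integral parts to nearby points.\<close>

lemma intpart_add:
  assumes "nv h \<le> 1"
  shows "intpart nv C \<pi> (z + h) = intpart nv C \<pi> z + h"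
  using intpart[of z] nv_add_le[of "intpart nv C \<pi> z" h] assms by (intro intpart_eq) auto

text \<open>
  Multiplying only the fractional part by the uniformizer contracts the set of points with small
  integral part by one level, which saves a factor \<open>q\<close>.
\<close>

lemma card_spaced_small_intpart_le:
  assumes "finite A" "\<And>a. a \<in> A \<Longrightarrow> nv (intpart nv C \<pi> a) < 1"
    and "\<And>a b. a \<in> A \<Longrightarrow> b \<in> A \<Longrightarrow> nv (a - b) \<le> real q powi j"
    and "\<And>a b. a \<in> A \<Longrightarrow> b \<in> A \<Longrightarrow> a \<noteq> b \<Longrightarrow> real q powi (j - int m) < nv (a - b)"
    and "0 \<le> j" "j < int m"
  shows "card A \<le> q ^ (m - 1)"
proof -
  let ?i = "intpart nv C \<pi>"
  \<comment> \<open>Under \<open>g\<close> the diameter exponent drops from \<open>j\<close> to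
    \<open>j - 1\<close> while the separation exponent \<open>j - m\<close> is kept, so the count
    becomes \<open>q ^ (m - 1)\<close>.\<close>
  define g where "g z = \<pi> * (z - ?i z) + ?i z" for z
  have m: "j - 1 - int (m - 1) = j - int m" using assms(5,6) by simp
  have g: "nv (g a - g b) \<le> real q powi (j - 1)" "real q powi (j - int m) < nv (g a - g b)"
    if a: "a \<in> A" and b: "b \<in> A" and ab: "a \<noteq> b" for a b
  proof -
    define u v where "u = (a - ?i a) - (b - ?i b)" and "v = ?i a - ?i b"
    have gd: "g a - g b = \<pi> * u + v" and d: "a - b = u + v"
      by (simp_all add: g_def u_def v_def algebra_simps)
    have v1: "nv v < 1" using nv_diff_le[of "?i a" "?i b"] assms(2)[OF a] assms(2)[OF b]
      by (simp add: v_def)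
    then have v: "nv v \<le> real q powi (-1)" using nv_discrete[of v 0] by simp
    have "nv (g a - g b) \<le> real q powi (j - 1) \<and> real q powi (j - int m) < nv (g a - g b)"
    proof (cases "u = 0")
      \<comment> \<open>With equal fractional parts \<open>g\<close> keeps the distance. It is at
        most \<open>1 / q\<close> because both integral parts lie in the maximal ideal, and
        \<open>0 \<le> j\<close> puts this within the new diameter.\<close>
      case True
      then have "g a - g b = v" "a - b = v" using gd d by auto
      moreover have "real q powi (-1) \<le> real q powi (j - 1)" using assms(5) by (subst q_powi_le_iff) simp
      ultimately show ?thesis using v assms(4)[OF a b ab] by auto
    next
      \<comment> \<open>Unequal fractional parts give \<open>nv u > 1\<close>, so \<open>u\<close>
        alone determines \<open>nv (a - b)\<close>. The product \<open>\<pi> * u\<close> still has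
        size at least 1, so it dominates \<open>v\<close>, and it respects the separation because
        \<open>j < int m\<close>.\<close>
      case False
      then have "\<not> nv u \<le> 1" using frac_parts_unique[OF intpart(2)[of a] intpart(2)[of b]]
        by (auto simp: u_def)
      moreover from this have "nv (a - b) = nv u" using nv_add_eq[of v u] v1 d by simp
      ultimately have u: "1 < nv u" "nv u \<le> real q powi j" using assms(3)[OF a b] by auto
      obtain k where k: "nv u = real q powi k" using nv_value[OF False] by blast
      have k1: "1 \<le> k" "k \<le> j" using u q_powi_less_iff[of 0 k] by (auto simp: k q_powi_le_iff)
      have pu: "nv (\<pi> * u) = real q powi (k - 1)"
        using q_gt by (simp add: nv_mult nv_uniformizer k power_int_diff)
      have "1 \<le> real q powi (k - 1)" using k1 q_powi_le_iff[of 0 "k - 1"] by simp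
      then have "nv (g a - g b) = real q powi (k - 1)"
        using nv_add_eq[of v "\<pi> * u"] v1 pu gd by simp
      then show ?thesis using k1 assms(5,6) by (simp add: q_powi_le_iff q_powi_less_iff)
    qed
    then show "nv (g a - g b) \<le> real q powi (j - 1)" "real q powi (j - int m) < nv (g a - g b)"
      by auto
  qed
  have "inj_on g A"
  proof (rule inj_onI, rule ccontr)
    fix a b assume "a \<in> A" "b \<in> A" "g a = g b" "a \<noteq> b"
    then show False using g(2)[of a b] q_powi_pos[of "j - int m"] by simp
  qed
  moreover have "card (g ` A) \<le> q ^ (m - 1)"
  proof (rule card_spaced_le[of _ "j - 1"])
    show "finite (g ` A)" using assms(1) by simp
  next
    fix x y assume "x \<in> g ` A" "y \<in> g ` A"
    then obtain a b where "a \<in> A" "b \<in> A" "x = g a" "y = g b" by blast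
    then show "nv (x - y) \<le> real q powi (j - 1)"
      using g(1)[of a b] q_powi_pos[of "j - 1"] by (cases "a = b") auto
    assume "x \<noteq> y"
    then show "real q powi (j - 1 - int (m - 1)) < nv (x - y)"
      unfolding m using \<open>a \<in> A\<close> \<open>b \<in> A\<close> \<open>x = g a\<close> \<open>y = g b\<close> g(2)[of a b] by auto
  qed
  ultimately show ?thesis by (simp add: card_image)
qed

section \<open>Absolute values of natural numbers\<close>

text \<open>Pigeonhole: two of the \<open>q + 1\<close> integers from 0 to \<open>q\<close> share a
  digit, so their difference lies in the maximal ideal.\<close>

lemma ex_nat_nv_less_1: "\<exists>n>0. nv (of_nat n) < 1"
proof -
  define f where "f i = digit (of_nat i)" for i :: nat
  have "\<not> inj_on f {..q}"
  proof
    assume "inj_on f {..q}"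
    moreover have "f ` {..q} \<subseteq> C" using digit(1) nv_of_nat_le by (auto simp: f_def)
    ultimately have "card {..q} \<le> card C" using finite_C by (intro card_inj_on_le)
    then show False by (simp add: card_C)
  qed
  then obtain i j where "i \<noteq> j" "f i = f j" by (auto simp: inj_on_def)
  then obtain i j where ij: "i < j" "f i = f j" by (metis linorder_neqE_nat)
  have "nv (of_nat j - of_nat i) < 1"
    using nv_diff_ultra[of "of_nat j" "of_nat i" "f i"] digit(2)[of "of_nat i"]
      digit(2)[of "of_nat j"] nv_of_nat_le ij nv_diff_commute[of "f i"] by (simp add: f_def)
  then show ?thesis using ij by (intro exI[of _ "j - i"]) (simp add: of_nat_diff)
qed

text \<open>With \<open>p\<close> the residue characteristic, \<open>nv (of_nat n)\<close> can be
  small only if a high power of \<open>p\<close> divides \<open>n\<close>. The exponent in the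
  modulus \<open>p ^ q\<close> is chosen to make it exceed \<open>q\<close>.\<close>

lemma ex_modulus:
  "\<exists>M k :: nat. q < M \<and> (\<forall>n. \<not> M dvd n \<longrightarrow> 1 / real q ^ k \<le> nv (of_nat n))"
proof -
  define p where "p = (LEAST n. n > 0 \<and> nv (of_nat n) < 1)"
  have p: "p > 0" "nv (of_nat p) < 1"
    using LeastI_ex[OF ex_nat_nv_less_1] by (auto simp: p_def)
  have least: "nv (of_nat r) = 1" if "0 < r" "r < p" for r
    using not_less_Least[of r "\<lambda>n. n > 0 \<and> nv (of_nat n) < 1"] that nv_of_nat_le[of r]
    by (auto simp: p_def)
  \<comment> \<open>The remainder modulo \<open>p\<close> is nonzero and has absolute value 1 by
    minimality of \<open>p\<close>; it dominates the multiple of \<open>p\<close>.\<close>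
  have unit: "nv (of_nat n) = 1" if "\<not> p dvd n" for n
  proof -
    have "nv (of_nat (n mod p)) = 1" using that p by (intro least) (auto simp: mod_greater_zero_iff_not_dvd)
    moreover have "nv (of_nat (p * (n div p))) \<le> nv (of_nat p)"
      using nv_of_nat_le[of "n div p"] by (simp add: nv_mult mult_left_le)
    moreover have "of_nat n = (of_nat (n mod p) + of_nat (p * (n div p)) :: 'a)"
      by (metis mod_mult_div_eq of_nat_add)
    ultimately show ?thesis using nv_add_eq p(2) by (metis order_le_less_trans)
  qed
  have bound: "nv (of_nat p) ^ j \<le> nv (of_nat n)" if "\<not> p ^ j dvd n" for j n
    using that
  proof (induction j arbitrary: n)
    case (Suc j)
    show ?case
    proof (cases "p dvd n")
      case True
      then obtain k where k: "n = p * k" by blast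
      then have "\<not> p ^ j dvd k" using Suc.prems by auto
      then show ?thesis using Suc.IH[of k] k by (simp add: nv_mult mult_left_mono)
    next
      case False
      then show ?thesis using unit[OF False] p(2) by (metis less_imp_le nv_nonneg power_le_one)
    qed
  qed simp
  have "p \<noteq> 1" using p by auto
  then have "p \<ge> 2" using p by simp
  then have "q < p ^ q" using order_less_le_trans[OF less_exp[of q] power_mono[of 2 p q]] by simp
  \<comment> \<open>Characteristic 0 enters here: \<open>of_nat p\<close> is nonzero, so
    \<open>nv (of_nat p) ^ q\<close> is positive and lies above some power of
    \<open>1 / real q\<close>.\<close>
  moreover obtain k where "(1 / real q) ^ k < nv (of_nat p) ^ q"
    using real_arch_pow_inv[of "nv (of_nat p) ^ q" "1 / real q"] char_0[OF p(1)] q_gt by auto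
  ultimately show ?thesis
    using bound[of q]
    by (intro exI[of _ "p ^ q"] exI[of _ k]) (force simp: power_one_over)
qed

section \<open>Dimension bounds\<close>

text \<open>A separated family of the maximal size \<open>q ^ n\<close> covers the ball: a point
  missed by the small balls could be added to it, against \<open>card_spaced_le\<close>.\<close>

lemma ball_cover:
  "\<exists>f :: nat \<Rightarrow> 'a. \<forall>z. nv z \<le> real q powi e \<longrightarrow>
     (\<exists>l<q ^ n. nv (z - f l) \<le> real q powi (e - int n))"
proof -
  obtain S where "finite S \<and> card S = q ^ n \<and> (\<forall>a\<in>S. nv a \<le> real q powi e) \<and>
     (\<forall>a\<in>S. \<forall>b\<in>S. a \<noteq> b \<longrightarrow> real q powi (e - int n) < nv (a - b))"
    using ex_spaced ..
  then have S: "finite S" "card S = q ^ n" "\<And>a. a \<in> S \<Longrightarrow> nv a \<le> real q powi e"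
    "\<And>a b. a \<in> S \<Longrightarrow> b \<in> S \<Longrightarrow> a \<noteq> b \<Longrightarrow> real q powi (e - int n) < nv (a - b)"
    by simp_all
  obtain f where f: "bij_betw f {0..<q ^ n} S"
    using ex_bij_betw_nat_finite[OF S(1)] S(2) by metis
  have "\<exists>l<q ^ n. nv (z - f l) \<le> real q powi (e - int n)" if z: "nv z \<le> real q powi e" for z
  proof (rule ccontr)
    assume neg: "\<not> ?thesis"
    have far: "real q powi (e - int n) < nv (z - a)" if "a \<in> S" for a
    proof -
      have "a \<in> f ` {0..<q ^ n}" using f that by (simp add: bij_betw_def)
      then obtain l where "l < q ^ n" "a = f l" by auto
      then show ?thesis using neg by force
    qed
    then have zS: "z \<notin> S" using q_powi_pos[of "e - int n"] by force
    have "card (insert z S) \<le> q ^ n"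
    proof (rule card_spaced_le[of _ e])
      show "finite (insert z S)" using S(1) by simp
    next
      fix a b assume ab: "a \<in> insert z S" "b \<in> insert z S"
      then have "nv a \<le> real q powi e" "nv b \<le> real q powi e" using S(3) z by auto
      then show "nv (a - b) \<le> real q powi e" using nv_diff_le[of a b] by linarith
      assume "a \<noteq> b"
      then show "real q powi (e - int n) < nv (a - b)"
        using ab S(4)[of a b] far[of a] far[of b] nv_diff_commute[of a z] by auto
    qed
    then show False using zS S(1,2) by simp
  qed
  then show ?thesis by blast
qed

text \<open>The ball of radius \<open>q ^ j\<close> is covered at cost at most
  \<open>q ^ j * (q powr (1 - s)) ^ k\<close>, which tends to 0 as \<open>k\<close> grows. Choosing
  \<open>k\<close> separately for each \<open>j\<close> keeps the sum over all \<open>j\<close>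
  below any given \<open>\<epsilon>\<close>.\<close>

lemma hausdorff_measure_eq_0:
  assumes s: "1 < s"
  shows "hausdorff_measure (\<lambda>x y. nv (x - y)) s E = 0"
proof -
  have bound: "hausdorff_pre (\<lambda>x y. nv (x - y)) s \<delta> E \<le> 0 + ennreal \<epsilon>" if \<delta>: "\<delta> > 0" and \<epsilon>: "\<epsilon> > 0" for \<delta> \<epsilon>
  proof -
    have rad: "real q powi (int j - int (j + k)) = (1 / real q) ^ k" for j k
      by (simp add: power_int_minus power_one_over inverse_eq_divide)
    have "\<exists>k. (1 / real q) ^ k \<le> \<delta> \<and>
        real (q ^ (j + k)) * ((1 / real q) ^ k) powr s \<le> \<epsilon> * (1/2) ^ Suc j" for j
    proof -
      have "(\<lambda>k. (1 / real q) ^ k) \<longlonglongrightarrow> 0" using q_gt by (intro LIMSEQ_realpow_zero) auto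
      then have "eventually (\<lambda>k. (1 / real q) ^ k < \<delta>) sequentially"
        using \<delta> by (rule order_tendstoD)
      moreover have "(\<lambda>k. (real q powr (1 - s)) ^ k) \<longlonglongrightarrow> 0"
        using q_gt s by (intro LIMSEQ_realpow_zero) (auto simp: powr_less_one)
      then have "eventually (\<lambda>k. (real q powr (1 - s)) ^ k < \<epsilon> * (1/2) ^ Suc j / real q ^ j) sequentially"
        using \<epsilon> q_gt by (intro order_tendstoD) auto
      ultimately obtain k where k: "(1 / real q) ^ k < \<delta>"
        "(real q powr (1 - s)) ^ k < \<epsilon> * (1/2) ^ Suc j / real q ^ j"
        by (metis (mono_tags, lifting) eventually_conj eventually_sequentially order_refl)
      have "real (q ^ (j + k)) * ((1 / real q) ^ k) powr s = real q ^ j * (real q powr (1 - s)) ^ k"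
      proof -
        have "real q ^ k * ((1 / real q) ^ k) powr s = (real q powr (1 - s)) ^ k"
          using q_gt
          by (simp add: powr_realpow[symmetric] powr_powr powr_divide powr_diff algebra_simps power_one_over)
        then show ?thesis by (simp add: power_add)
      qed
      then show ?thesis using k q_gt by (intro exI[of _ k]) (simp add: field_simps)
    qed
    then obtain k where k: "\<And>j. (1 / real q) ^ k j \<le> \<delta>"
      "\<And>j. real (q ^ (j + k j)) * ((1 / real q) ^ k j) powr s \<le> \<epsilon> * (1/2) ^ Suc j"
      by metis
    have "\<exists>f :: nat \<Rightarrow> 'a. \<forall>z. nv z \<le> real q powi int j \<longrightarrow>
        (\<exists>l<q ^ (j + k j). nv (z - f l) \<le> (1 / real q) ^ k j)" for j
      using ball_cover[of "int j" "j + k j"] unfolding rad .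
    then obtain f where f: "\<And>j z. nv z \<le> real q powi int j \<Longrightarrow>
        \<exists>l<q ^ (j + k j). nv (z - f j l) \<le> (1 / real q) ^ k j"
      by metis
    \<comment> \<open>Empty sets extend each finite cover to an infinite row, so that
      \<open>prod_decode\<close> can enumerate the double family; they cost
      \<open>0 powr s = 0\<close>.\<close>
    define V where "V = (\<lambda>(j, l). if l < q ^ (j + k j)
        then {z. nv (z - f j l) \<le> (1 / real q) ^ k j} else {})"
    define h where "h p = ennreal (mdiam (\<lambda>x y. nv (x - y)) (V p) powr s)" for p
    have V: "nv (x - y) \<le> (1 / real q) ^ k j" if "x \<in> V (j, l)" "y \<in> V (j, l)" for x y j l
      using that nv_diff_ultra[of x y "f j l"] nv_diff_commute[of "f j l" y]
      by (auto simp: V_def split: if_splits)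
    have h: "h (j, l) \<le> ennreal (((1 / real q) ^ k j) powr s)" for j l
      unfolding h_def using V[of _ j l] s
      by (intro ennreal_leI powr_mono2 mdiam_le mdiam_nonneg[where B = "(1 / real q) ^ k j"]) auto
    have h0: "h (j, l) = 0" if "\<not> l < q ^ (j + k j)" for j l
      using that by (simp add: h_def V_def mdiam_def)
    have row: "(\<Sum>l. h (j, l)) \<le> ennreal (\<epsilon> * (1/2) ^ Suc j)" for j
    proof -
      have "(\<Sum>l. h (j, l)) = (\<Sum>l<q ^ (j + k j). h (j, l))"
        using h0 by (intro suminf_finite) auto
      also have "\<dots> \<le> (\<Sum>l<q ^ (j + k j). ennreal (((1 / real q) ^ k j) powr s))"
        using h by (intro sum_mono)
      also have "\<dots> = ennreal (real (q ^ (j + k j)) * ((1 / real q) ^ k j) powr s)"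
        by (subst sum_ennreal) auto
      also have "\<dots> \<le> ennreal (\<epsilon> * (1/2) ^ Suc j)" using k(2) by (intro ennreal_leI)
      finally show ?thesis .
    qed
    have "hausdorff_pre (\<lambda>x y. nv (x - y)) s \<delta> E \<le> (\<Sum>i. h (prod_decode i))"
      unfolding hausdorff_pre_def h_def
    proof (rule INF_lower, intro CollectI conjI allI ballI)
      show "E \<subseteq> (\<Union>i. V (prod_decode i))"
      proof
        fix z assume "z \<in> E"
        obtain j where "nv z < real q ^ j" using real_arch_pow q_gt(1) by blast
        then have "nv z \<le> real q powi int j" by simp
        from f[OF this] obtain l where l: "l < q ^ (j + k j)" "nv (z - f j l) \<le> (1 / real q) ^ k j"
          by blast
        then have "z \<in> V (prod_decode (prod_encode (j, l)))" by (simp add: V_def)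
        then show "z \<in> (\<Union>i. V (prod_decode i))" by blast
      qed
    next
      fix i x y assume "x \<in> V (prod_decode i)" "y \<in> V (prod_decode i)"
      then have "nv (x - y) \<le> (1 / real q) ^ k (fst (prod_decode i))"
        using V[of x "fst (prod_decode i)" "snd (prod_decode i)" y] by simp
      then show "nv (x - y) \<le> \<delta>" using k(1) order_trans by blast
    qed
    also have "\<dots> = (\<Sum>j. \<Sum>l. h (j, l))"
      by (rule suminf_ennreal_2dimen) simp
    also have "\<dots> \<le> (\<Sum>j. ennreal (\<epsilon> * (1/2) ^ Suc j))"
      using row by (intro suminf_le) auto
    also have "\<dots> = ennreal (\<epsilon> * 1)"
      using \<epsilon> by (intro suminf_ennreal_eq sums_mult power_half_series) auto
    finally show ?thesis by simp
  qed
  have "hausdorff_pre (\<lambda>x y. nv (x - y)) s \<delta> E \<le> 0" if "\<delta> > 0" for \<delta>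
  proof (rule ennreal_le_epsilon)
    fix e :: real assume "0 < e"
    then show "hausdorff_pre (\<lambda>x y. nv (x - y)) s \<delta> E \<le> 0 + ennreal e" by (rule bound[OF that])
  qed
  then have "hausdorff_measure (\<lambda>x y. nv (x - y)) s E \<le> 0"
    unfolding hausdorff_measure_def by (intro SUP_least) simp
  then show ?thesis by simp
qed

section \<open>Lower bound for the dimension\<close>

text \<open>The test ball is the maximal ideal, the ball of radius \<open>1 / q\<close> about 0. Up
  to time \<open>N\<close> it is visited at most \<open>n\<^sub>0 + N div M\<close> times, so its
  limiting frequency is at most \<open>1 / M\<close>, less than the required
  \<open>1 / q\<close>.\<close>

lemma not_unif_distributed:
  assumes M: "q < M" and good: "\<And>n. n\<^sub>0 \<le> n \<Longrightarrow> \<not> M dvd n \<Longrightarrow> \<not> nv (s n) < 1"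
  shows "\<not> unif_distributed nv q s"
proof
  assume u: "unif_distributed nv q s"
  have lim: "(\<lambda>N. real (card {n \<in> {1..N}. nv (s n - 0) \<le> real q powi (- int 1)}) / real N)
      \<longlonglongrightarrow> real q powi (- int 1)"
    by (rule u[unfolded unif_distributed_def, THEN conjunct2, rule_format]) simp
  have M0: "M > 0" using M by simp
  have card: "card {n \<in> {1..N}. nv (s n - 0) \<le> real q powi (- int 1)} \<le> n\<^sub>0 + N div M" for N
  proof -
    have "{n \<in> {1..N}. nv (s n - 0) \<le> real q powi (- int 1)} \<subseteq> {..<n\<^sub>0} \<union> (\<lambda>i. M * i) ` {1..N div M}"
    proof
      fix n assume n: "n \<in> {n \<in> {1..N}. nv (s n - 0) \<le> real q powi (- int 1)}"
      then have "nv (s n) \<le> 1 / real q" by (simp add: inverse_eq_divide)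
      also have "\<dots> < 1" using q_gt by simp
      finally have "n < n\<^sub>0 \<or> M dvd n" using good[of n] by linarith
      then show "n \<in> {..<n\<^sub>0} \<union> (\<lambda>i. M * i) ` {1..N div M}"
      proof
        assume "M dvd n"
        then obtain i where i: "n = M * i" by blast
        then have "i \<ge> 1" "i \<le> N div M" using n M0 by (auto simp: less_eq_div_iff_mult_less_eq mult.commute Suc_le_eq)
        then show ?thesis using i by auto
      qed simp
    qed
    then have "card {n \<in> {1..N}. nv (s n - 0) \<le> real q powi (- int 1)} \<le>
        card ({..<n\<^sub>0} \<union> (\<lambda>i. M * i) ` {1..N div M})"
      by (intro card_mono) auto
    also have "\<dots> \<le> card {..<n\<^sub>0} + card ((\<lambda>i. M * i) ` {1..N div M})" by (rule card_Un_le)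
    also have "\<dots> \<le> n\<^sub>0 + N div M" using card_image_le[of "{1..N div M}" "\<lambda>i. M * i"] by simp
    finally show ?thesis .
  qed
  have upper: "(\<lambda>N. real n\<^sub>0 / real N + 1 / real M) \<longlonglongrightarrow> 0 + 1 / real M"
    by (intro tendsto_add tendsto_const lim_const_over_n)
  have "real q powi (- int 1) \<le> 0 + 1 / real M"
  proof (rule LIMSEQ_le[OF lim upper], intro exI[of _ 1] allI impI)
    fix N :: nat assume N: "1 \<le> N"
    have "real (card {n \<in> {1..N}. nv (s n - 0) \<le> real q powi (- int 1)}) \<le> real n\<^sub>0 + real (N div M)"
      using card[of N] by linarith
    also have "\<dots> \<le> real n\<^sub>0 + real N / real M" using of_nat_div_le_of_nat[of N M] by simp
    finally show "real (card {n \<in> {1..N}. nv (s n - 0) \<le> real q powi (- int 1)}) / real N \<le>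
        real n\<^sub>0 / real N + 1 / real M"
      using N by (simp add: divide_le_eq distrib_right)
  qed
  then show False using M q_gt by (simp add: field_simps)
qed

text \<open>The tree criterion is applied to balls about points of absolute value
  \<open>q ^ m\<close>; the step from level \<open>t\<close> to \<open>Suc t\<close> deals with the
  exponent \<open>n\<^sub>0 + t\<close>.\<close>

lemma hausdorff_measure_ne_0:
  assumes \<alpha>: "\<alpha> \<noteq> 0" and s: "0 < s" "s < 1"
  shows "hausdorff_measure (\<lambda>x y. nv (x - y)) s
    {x. nv x > 1 \<and> \<not> unif_distributed nv q (\<lambda>n. intpart nv C \<pi> (\<alpha> * x ^ n))} \<noteq> 0"
proof -
  obtain M k :: nat where M: "q < M" "\<And>n. \<not> M dvd n \<Longrightarrow> 1 / real q ^ k \<le> nv (of_nat n)"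
    using ex_modulus by blast
  obtain A where A: "nv \<alpha> = real q powi A" using nv_value[OF \<alpha>] by blast
  obtain m\<^sub>0 :: nat where m0: "1 / (1 - s) \<le> real m\<^sub>0" using real_arch_simple by blast
  \<comment> \<open>The choice of \<open>m\<^sub>0\<close> gives \<open>m * s \<le> m - 1\<close>,
    so \<open>q ^ (m - 1)\<close> surviving children suffice for \<open>Q powr s\<close>. The bound
    \<open>k + 1 \<le> m\<close> compensates for the factor \<open>nv (of_nat n)\<close>, which may
    be as small as \<open>1 / q ^ k\<close>.\<close>
  define m where "m = max m\<^sub>0 (k + 1)"
  have m: "k + 1 \<le> m" "real m * s \<le> real m - 1"
  proof -
    have "1 / (1 - s) \<le> real m" using m0 by (simp add: m_def)
    then show "real m * s \<le> real m - 1" using s by (simp add: field_simps)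
  qed (simp add: m_def)
  let ?i = "intpart nv C \<pi>"
  define Q where "Q = real q ^ m"
  have Q: "Q = real q powi int m" "Q > 1" using m(1) q_gt by (auto simp: Q_def)
  define n\<^sub>0 where "n\<^sub>0 = nat \<bar>A\<bar> + k + 2"
  text \<open>
    Balls of radius \<open>q powi e n\<close> are mapped by \<open>\<lambda>x. \<alpha> * x ^ n\<close> to balls of radius at least 1,
    balls of the next level to balls of radius at most \<open>1 / q\<close>.
  \<close>
  define e where "e n = int m - (int n - 1) * int m - 1 - A" for n
  have e_Suc: "e (Suc n) = e n - int m" for n by (simp add: e_def algebra_simps)
  \<comment> \<open>For \<open>n\<close> not divisible by \<open>M\<close>,
    \<open>q powi (m - k)\<close> is a lower bound for \<open>nv (of_nat n) * nv b\<close> when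
    \<open>nv b = Q\<close>. A radius below it satisfies the hypothesis of
    \<open>nv_power_diff_eq\<close>.\<close>
  have e_less: "e n < int m - int k" if "n\<^sub>0 \<le> n" for n
  proof -
    have "(int n - 1) * 1 \<le> (int n - 1) * int m"
      using that m(1) by (intro mult_left_mono) (auto simp: n\<^sub>0_def)
    then have "int n - 1 \<le> (int n - 1) * int m" by simp
    moreover have "\<bar>A\<bar> + int k + 2 \<le> int n" using that unfolding n\<^sub>0_def by linarith
    ultimately show ?thesis
      unfolding e_def by (smt (verit))
  qed
  have radius: "real q powi (e n\<^sub>0) / Q ^ t = real q powi e (n\<^sub>0 + t)" for t
  proof (induction t)
    case (Suc t)
    have "real q powi (e n\<^sub>0) / Q ^ Suc t = real q powi e (n\<^sub>0 + t) / Q" by (simp flip: Suc)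
    also have "\<dots> = real q powi e (n\<^sub>0 + Suc t)"
      using q_gt by (simp add: e_Suc power_int_diff Q)
    finally show ?case .
  qed simp
  \<comment> \<open>The multiplier is \<open>nv (\<alpha> * of_nat n * b ^ (n - 1))\<close>. With
    \<open>nv (of_nat n) = q powi (- \<nu>)\<close> and the definition of \<open>e\<close> it takes
    the stated form, and the loss \<open>\<nu>\<close> is at most \<open>k\<close>.\<close>
  have dist: "\<exists>\<nu>. 0 \<le> \<nu> \<and> \<nu> \<le> int k \<and> (\<forall>a b. nv b = Q \<longrightarrow> nv (a - b) \<le> real q powi e n \<longrightarrow>
      nv (\<alpha> * a ^ n - \<alpha> * b ^ n) = real q powi (int m - 1 - e n - \<nu>) * nv (a - b))"
    if n: "n\<^sub>0 \<le> n" "\<not> M dvd n" for n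
  proof -
    have "n > 0" using n(1) by (simp add: n\<^sub>0_def)
    then obtain j where j: "nv (of_nat n) = real q powi j" using nv_value[OF char_0] by blast
    have "real q powi (- int k) \<le> real q powi j"
      using M(2)[OF n(2)] by (simp add: power_int_minus inverse_eq_divide flip: j)
    then have j1: "- int k \<le> j" by (simp add: q_powi_le_iff)
    have j2: "j \<le> 0" using nv_of_nat_le[of n] q_powi_le_iff[of j 0] by (simp add: j)
    have "nv (\<alpha> * a ^ n - \<alpha> * b ^ n) = real q powi (int m - 1 - e n - (- j)) * nv (a - b)"
      if b: "nv b = Q" and ab: "nv (a - b) \<le> real q powi e n" for a b
    proof -
      have "nv (a - b) < nv (of_nat n) * nv b"
      proof -
        have "real q powi e n < real q powi (j + int m)"
          unfolding q_powi_less_iff using e_less[OF n(1)] j1 by simp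
        then show ?thesis using ab by (simp add: j b Q q_powi_add)
      qed
      from nv_power_diff_eq[OF this]
      have "nv (\<alpha> * a ^ n - \<alpha> * b ^ n) =
          real q powi A * (real q powi j * (real q powi int m) ^ (n - 1) * nv (a - b))"
        by (simp add: A nv_mult j b Q flip: right_diff_distrib)
      also have "(real q powi int m) ^ (n - 1) = real q powi ((int n - 1) * int m)"
        using \<open>n > 0\<close> by (simp add: power_int_mult of_nat_diff mult.commute flip: power_int_of_nat)
      also have "real q powi A * (real q powi j * real q powi ((int n - 1) * int m) * nv (a - b)) =
          real q powi (A + j + (int n - 1) * int m) * nv (a - b)"
        by (simp add: q_powi_add)
      also have "A + j + (int n - 1) * int m = int m - 1 - e n - (- j)" by (simp add: e_def)
      finally show ?thesis .
    qed
    moreover have "0 \<le> - j" "- j \<le> int k" using j1 j2 by auto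
    ultimately show ?thesis by blast
  qed
  \<comment> \<open>The shift by one reflects that a node at level \<open>t > 0\<close> was selected
    with the exponent \<open>n\<^sub>0 + t - 1\<close>; the root carries only the condition on
    \<open>nv x\<close>.\<close>
  define P where "P t x \<longleftrightarrow> nv x = Q \<and>
      (0 < t \<longrightarrow> \<not> M dvd (n\<^sub>0 + t - 1) \<longrightarrow> \<not> nv (?i (\<alpha> * x ^ (n\<^sub>0 + t - 1))) < 1)" for t x
  show ?thesis
  proof (rule hausdorff_measure_tree_nonzero[where P = P and Q = Q and R = "real q powi (e n\<^sub>0)"])
    show "nv (x - y) = nv (y - x)" for x y by (rule nv_diff_commute)
    show "nv (x - z) \<le> max (nv (x - y)) (nv (y - z))" for x y z by (rule nv_diff_ultra)
    show "\<exists>L. \<forall>e>0. \<exists>N. \<forall>n\<ge>N. nv (X n - L) < e"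
      if "\<forall>e>0. \<exists>N. \<forall>m\<ge>N. \<forall>n\<ge>N. nv (X m - X n) < e" for X :: "nat \<Rightarrow> 'a"
      using that by (rule nv_complete)
    show "P 0 (\<pi> powi (- int m))" unfolding P_def Q by (simp add: nv_uniformizer_powi)
  next
    fix t x assume x: "P t x"
    define n where "n = n\<^sub>0 + t"
    have n: "n\<^sub>0 \<le> n" "n\<^sub>0 + Suc t - 1 = n" by (simp_all add: n_def)
    have nx: "nv x = Q" using x by (simp add: P_def)
    obtain S where "finite S \<and> card S = q ^ m \<and> (\<forall>a\<in>S. nv a \<le> real q powi e n) \<and>
       (\<forall>a\<in>S. \<forall>b\<in>S. a \<noteq> b \<longrightarrow> real q powi (e n - int m) < nv (a - b))"
      using ex_spaced ..
    then have S: "finite S" "card S = q ^ m" "\<And>a. a \<in> S \<Longrightarrow> nv a \<le> real q powi e n"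
      "\<And>a b. a \<in> S \<Longrightarrow> b \<in> S \<Longrightarrow> a \<noteq> b \<Longrightarrow> real q powi (e n - int m) < nv (a - b)"
      by simp_all
    define B where "B = (\<lambda>a. x + a) ` S"
    have B: "finite B" "card B = q ^ m" using S(1,2) by (auto simp: B_def card_image)
    have Bx: "nv (a - x) \<le> real q powi e n" if "a \<in> B" for a using that S(3) by (auto simp: B_def)
    have Bd: "nv (a - b) \<le> real q powi e n" if "a \<in> B" "b \<in> B" for a b
      using nv_diff_ultra[of a b x] Bx[OF that(1)] Bx[OF that(2)] nv_diff_commute[of x b] by linarith
    have Bs: "real q powi (e n - int m) < nv (a - b)" if "a \<in> B" "b \<in> B" "a \<noteq> b" for a b
      using that S(4) by (auto simp: B_def)
    have "real q powi e n < Q" unfolding Q q_powi_less_iff using e_less[OF n(1)] by simp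
    then have BQ: "nv a = Q" if "a \<in> B" for a
      using nv_add_eq[of "a - x" x] Bx[OF that] nx by simp
    define bad where "bad = {a \<in> B. \<not> M dvd n \<and> nv (?i (\<alpha> * a ^ n)) < 1}"
    \<comment> \<open>The images of the bad points have distances at most \<open>q powi j\<close>
      and above \<open>q powi (j - m)\<close>, where \<open>j = m - 1 - \<nu>\<close>. Since
      \<open>\<nu> \<le> k < m\<close>, this \<open>j\<close> is nonnegative and the count for small
      integral parts applies.\<close>
    have bad: "card bad \<le> q ^ (m - 1)"
    proof (cases "M dvd n")
      case False
      let ?f = "\<lambda>a. \<alpha> * a ^ n"
      obtain \<nu> where \<nu>: "0 \<le> \<nu>" "\<nu> \<le> int k" "\<And>a b. nv b = Q \<Longrightarrow> nv (a - b) \<le> real q powi e n \<Longrightarrow>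
          nv (?f a - ?f b) = real q powi (int m - 1 - e n - \<nu>) * nv (a - b)"
        using dist[OF n(1) False] by blast
      have eq: "nv (?f a - ?f b) = real q powi (int m - 1 - e n - \<nu>) * nv (a - b)"
        if "a \<in> B" "b \<in> B" for a b
        using \<nu>(3) BQ[OF that(2)] Bd[OF that] by simp
      have up: "nv (?f a - ?f b) \<le> real q powi (int m - 1 - \<nu>)" if "a \<in> B" "b \<in> B" for a b
      proof -
        have "nv (?f a - ?f b) \<le> real q powi (int m - 1 - e n - \<nu>) * real q powi e n"
          unfolding eq[OF that] using Bd[OF that] q_powi_pos[THEN less_imp_le] by (intro mult_left_mono) auto
        also have "\<dots> = real q powi (int m - 1 - \<nu>)"
          unfolding q_powi_add[symmetric]
          by (rule arg_cong[where f = "\<lambda>i. real q powi i"]) simp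
        finally show ?thesis .
      qed
      have low: "real q powi (int m - 1 - \<nu> - int m) < nv (?f a - ?f b)"
        if "a \<in> B" "b \<in> B" "a \<noteq> b" for a b
      proof -
        have "real q powi (int m - 1 - \<nu> - int m) =
            real q powi (int m - 1 - e n - \<nu>) * real q powi (e n - int m)"
          unfolding q_powi_add[symmetric]
          by (rule arg_cong[where f = "\<lambda>i. real q powi i"]) simp
        also have "\<dots> < nv (?f a - ?f b)"
          unfolding eq[OF that(1,2)] using Bs[OF that] q_powi_pos by (intro mult_strict_left_mono) auto
        finally show ?thesis .
      qed
      have "bad \<subseteq> B" by (auto simp: bad_def)
      have "inj_on ?f bad"
      proof (rule inj_onI, rule ccontr)
        fix a b assume ab: "a \<in> bad" "b \<in> bad" "?f a = ?f b" "a \<noteq> b"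
        then have "a \<in> B" "b \<in> B" using \<open>bad \<subseteq> B\<close> by auto
        from low[OF this ab(4)] show False
          using ab(3) q_powi_pos[of "int m - 1 - \<nu> - int m"] by simp
      qed
      moreover have "card (?f ` bad) \<le> q ^ (m - 1)"
      proof (rule card_spaced_small_intpart_le[of _ "int m - 1 - \<nu>"])
        show "finite (?f ` bad)" using B(1) \<open>bad \<subseteq> B\<close> finite_subset by blast
        show "nv (?i y) < 1" if "y \<in> ?f ` bad" for y using that by (auto simp: bad_def)
        show "nv (y - z) \<le> real q powi (int m - 1 - \<nu>)" if "y \<in> ?f ` bad" "z \<in> ?f ` bad" for y z
          using that up \<open>bad \<subseteq> B\<close> by blast
        show "real q powi (int m - 1 - \<nu> - int m) < nv (y - z)"
          if "y \<in> ?f ` bad" "z \<in> ?f ` bad" "y \<noteq> z" for y z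
          using that low \<open>bad \<subseteq> B\<close> by blast
      qed (use \<nu>(1,2) m(1) in auto)
      ultimately show ?thesis by (simp add: card_image)
    qed (simp add: bad_def)
    have "Q powr s = real q powr (real m * s)"
      using q_gt by (simp add: Q_def powr_powr flip: powr_realpow)
    also have "\<dots> \<le> real q powr (real m - 1)" using m(2) q_gt by (intro powr_mono) auto
    also have "\<dots> = real (q ^ (m - 1))"
      using m(1) q_gt by (simp add: powr_realpow[symmetric] of_nat_diff)
    \<comment> \<open>At least \<open>q ^ m - q ^ (m - 1)\<close> children survive, which is at
      least \<open>q ^ (m - 1)\<close> because \<open>q\<close> is at least 2.\<close>
    also have "q ^ (m - 1) \<le> card (B - bad)"
    proof -
      have "q ^ (m - 1) + q ^ (m - 1) \<le> q * q ^ (m - 1)" using q_ge_2 by (simp flip: mult_2)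
      also have "\<dots> = q ^ m" using m(1) by (simp flip: power_Suc)
      finally show ?thesis using bad B by (simp add: card_Diff_subset bad_def)
    qed
    finally have "Q powr s \<le> card (B - bad)" by simp
    moreover have "P (Suc t) a" if "a \<in> B - bad" for a
      using that BQ unfolding P_def n(2) by (auto simp: bad_def)
    ultimately show "\<exists>A. finite A \<and> Q powr s \<le> card A \<and>
        (\<forall>a\<in>A. P (Suc t) a \<and> nv (a - x) \<le> real q powi (e n\<^sub>0) / Q ^ t) \<and>
        (\<forall>a\<in>A. \<forall>b\<in>A. a \<noteq> b \<longrightarrow> real q powi (e n\<^sub>0) / Q ^ Suc t < nv (a - b))"
      unfolding radius add_Suc_right e_Suc n_def[symmetric]
      using B(1) Bx Bs by (intro exI[of _ "B - bad"]) auto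
  next
    fix X L assume XL: "\<And>t. P t (X t) \<and> nv (L - X t) \<le> real q powi (e n\<^sub>0) / Q ^ t"
    have LX: "nv (L - X t) \<le> real q powi e (n\<^sub>0 + t)" for t using XL[of t] by (simp add: radius)
    have XQ: "nv (X t) = Q" for t using XL[of t] by (simp add: P_def)
    have "real q powi e n\<^sub>0 < Q" unfolding Q q_powi_less_iff using e_less[of n\<^sub>0] by simp
    then have LQ: "nv L = Q" using nv_add_eq[of "L - X 0" "X 0"] LX[of 0] XQ[of 0] by simp
    have "\<not> nv (?i (\<alpha> * L ^ n)) < 1" if n: "n\<^sub>0 \<le> n" "\<not> M dvd n" for n
    proof -
      \<comment> \<open>At level \<open>Suc (n - n\<^sub>0)\<close> the predicate \<open>P\<close>
        records the exponent \<open>n\<close>. As \<open>L\<close> lies within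
        \<open>q powi (e n - m)\<close> of \<open>y\<close>, the values at \<open>L\<close> and
        \<open>y\<close> differ by an element of the maximal ideal, and so do their integral
        parts.\<close>
      define y where "y = X (Suc (n - n\<^sub>0))"
      have y: "nv y = Q" "nv (L - y) \<le> real q powi (e n - int m)"
        using LX[of "Suc (n - n\<^sub>0)"] XQ n(1) by (simp_all add: y_def flip: e_Suc)
      have bad: "\<not> nv (?i (\<alpha> * y ^ n)) < 1"
        using XL[of "Suc (n - n\<^sub>0)"] n by (simp add: P_def y_def)
      have "real q powi (e n - int m) \<le> real q powi e n" by (simp add: q_powi_le_iff)
      then have "nv (L - y) \<le> real q powi e n" using y(2) by linarith
      then obtain \<nu> where \<nu>: "0 \<le> \<nu>"
        "nv (\<alpha> * L ^ n - \<alpha> * y ^ n) = real q powi (int m - 1 - e n - \<nu>) * nv (L - y)"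
        using dist[OF n] y(1) by blast
      have "nv (\<alpha> * L ^ n - \<alpha> * y ^ n) \<le> real q powi (int m - 1 - e n - \<nu>) * real q powi (e n - int m)"
        unfolding \<nu>(2) using y(2) q_powi_pos[THEN less_imp_le] by (intro mult_left_mono) auto
      also have "\<dots> = real q powi (- 1 - \<nu>)"
        unfolding q_powi_add[symmetric]
        by (rule arg_cong[where f = "\<lambda>i. real q powi i"]) simp
      also have "\<dots> < real q powi 0" unfolding q_powi_less_iff using \<nu>(1) by simp
      finally have h: "nv (\<alpha> * L ^ n - \<alpha> * y ^ n) < 1" by simp
      show ?thesis
      proof
        assume "nv (?i (\<alpha> * L ^ n)) < 1"
        moreover have "?i (\<alpha> * y ^ n) = ?i (\<alpha> * L ^ n) + (\<alpha> * y ^ n - \<alpha> * L ^ n)"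
          using intpart_add[of "\<alpha> * y ^ n - \<alpha> * L ^ n" "\<alpha> * L ^ n"] h nv_diff_commute by simp
        ultimately have "nv (?i (\<alpha> * y ^ n)) < 1"
          using nv_add_le[of "?i (\<alpha> * L ^ n)" "\<alpha> * y ^ n - \<alpha> * L ^ n"] h
            nv_diff_commute[of "\<alpha> * L ^ n" "\<alpha> * y ^ n"] by simp
        then show False using bad by simp
      qed
    qed
    then have "\<not> unif_distributed nv q (\<lambda>n. ?i (\<alpha> * L ^ n))"
      by (rule not_unif_distributed[OF M(1)])
    then show "L \<in> {x. nv x > 1 \<and> \<not> unif_distributed nv q (\<lambda>n. ?i (\<alpha> * x ^ n))}"
      using LQ Q(2) by simp
  qed (use s Q(2) q_gt in auto)
qed

end

theorem theorem1p7:
  fixes nv :: "'a::field \<Rightarrow> real" and q :: nat and C :: "'a set" and \<pi> \<alpha> :: 'a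
  assumes "local_field_char0 nv q"
    and "nv \<pi> = 1 / real q"
    and "C \<subseteq> {x. nv x \<le> 1}" and "0 \<in> C"
    and "\<forall>x. nv x \<le> 1 \<longrightarrow> (\<exists>!c. c \<in> C \<and> nv (x - c) < 1)"
    and "\<alpha> \<noteq> 0"
  shows "hausdorff_dim (\<lambda>x y. nv (x - y))
           {x. nv x > 1 \<and> \<not> unif_distributed nv q (\<lambda>n. intpart nv C \<pi> (\<alpha> * x ^ n))} = 1"
proof -
  interpret local_field_digits nv q C \<pi>
    using assms by unfold_locales
  let ?E = "{x. nv x > 1 \<and> \<not> unif_distributed nv q (\<lambda>n. intpart nv C \<pi> (\<alpha> * x ^ n))}"
  show ?thesis
    unfolding hausdorff_dim_def
  proof (rule antisym)
    show "1 \<le> Inf (ereal ` {s. 0 < s \<and> hausdorff_measure (\<lambda>x y. nv (x - y)) s ?E = 0})"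
    proof (intro Inf_greatest, clarify)
      fix s assume "0 < s" "hausdorff_measure (\<lambda>x y. nv (x - y)) s ?E = 0"
      then have "\<not> s < 1" using hausdorff_measure_ne_0[OF assms(6)] by blast
      then show "1 \<le> ereal s" by (simp add: one_ereal_def)
    qed
    show "Inf (ereal ` {s. 0 < s \<and> hausdorff_measure (\<lambda>x y. nv (x - y)) s ?E = 0}) \<le> 1"
    proof (rule ereal_le_epsilon2)
      \<comment> \<open>The measure is known to vanish for every exponent \<open>1 + e\<close>, not
        at 1 itself, so the infimum is bounded up to an arbitrary \<open>e\<close>.\<close>
      fix e :: real assume "0 < e"
      then have "ereal (1 + e) \<in> ereal ` {s. 0 < s \<and> hausdorff_measure (\<lambda>x y. nv (x - y)) s ?E = 0}"
        using hausdorff_measure_eq_0[of "1 + e" ?E] by auto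
      from Inf_lower[OF this] show
        "Inf (ereal ` {s. 0 < s \<and> hausdorff_measure (\<lambda>x y. nv (x - y)) s ?E = 0}) \<le> 1 + ereal e"
        by (simp add: one_ereal_def)
    qed
  qed
qed

end
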